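(* Let $M\ge0$ be real and $K>2$ an integer. For $k\in\mathbb N\cup\{0\}$ let $\Xi_k$ be the decision map defined in the context (with this $M$), and let $\mathcal S^9_k$ be the set of nonnegative real numbers whose $k$-th digit after the decimal point is $9$. Then there is a class of inputs $\Omega=\bigcup_{m<N}\Omega_{m,N}$, with $\Omega_{m,N}\subset\mathbb R^m\times\mathbb R^{m\times N}$ nonempty, such that: (i) There does not exist any sequence of algorithms $\{\Gamma_j\}_{j\in\mathbb N}$ with output in $\{0,1\}$ so that, for all $\iota\in\Omega$, $\lim_{j\to\infty}\Gamma_j(\iota)=\Xi_K(\iota)$ and, if $\Gamma_j(\iota)=1$ for some $j\in\mathbb N$, then $\Xi_K(\iota)=\Gamma_j(\iota)=1$. (ii) There does not exist a randomised algorithm $\Gamma^{\mathrm{ran}}$, even with non-zero probability of not halting, such that, for all $\iota\in\Omega$, $\Gamma^{\mathrm{ran}}(\iota)=\Xi_K(\iota)$ with probability exceeding $\mathrm p>1/2$. Additionally, (iii) below holds whenever $M\notin\mathcal S^9_K$, and (iv) below holds whenever $M\notin\mathcal S^9_{K-1}$: (iii) There exists an algorithm $\Gamma$ (Turing or BSS machine) such that $\Gamma(\iota)=\Xi_{K-1}(\iota)$ for all $\iota\in\Omega$. However, any algorithm needs arbitrarily long time to compute $\Xi_{K-1}$: for any fixed dimensions $m<N$, any $T>0$ and any algorithm $\Gamma$ there exists $\iota\in\Omega_{m,N}$ such that either $\Gamma(\iota)\ne\Xi_{K-1}(\iota)$ or the runtime of $\Gamma$ on $\iota$ exceeds $T$.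 Moreover, for any randomised algorithm $\Gamma^{\mathrm{ran}}$ and $\mathrm p\in(0,1/2)$ there exists $\iota\in\Omega_{m,N}$ such that $$\mathbb P\big(\Gamma^{\mathrm{ran}}(\iota)\text{ is wrong or the runtime exceeds }T\big)>\mathrm p.$$ (iv) There exist a polynomial $\mathrm{pol}:\mathbb R\to\mathbb R$, a Turing machine and a BSS machine that both compute $\Xi_{K-2}$ for all inputs in $\Omega$, so that the number of arithmetic operations of both machines is bounded by $\mathrm{pol}(n)$, where $n=m+mN$ is the number of variables, and the number of digits required from the oracle is bounded by $\mathrm{pol}(\log n)$. Moreover, the space complexity of the Turing machine is bounded by $\mathrm{pol}(n)$. Finally, if one only considers (i)-(iii), $\Omega$ can be chosen with any fixed dimensions $m<N$ with $N\ge4$. Moreover, if one only considers (i), then $K$ can be chosen to be $1$.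
   Context: **Decision problem.** For $c=(1,\dots,1)\in\mathbb R^N$ and $k\in\mathbb N\cup\{0\}$ let $\langle x,c\rangle_k=\lfloor10^k\langle x,c\rangle\rfloor10^{-k}$. For an input $\iota=(y,A)\in\mathbb R^m\times\mathbb R^{m\times N}$, $\Xi_k(\iota)=1$ if there exists $x\in\mathbb R^N$ with $\langle x,c\rangle_k\le M$, $Ax=y$ and $x\ge0$ coordinatewise; otherwise $\Xi_k(\iota)=0$. Formally $\mathcal S^9_k=\bigcup_{n\in\mathbb N\cup\{0\}}\big[(n+0.9)10^{-(k-1)},(n+1)10^{-(k-1)}\big)$. **Inexact input.** Let $\mathbb D_n=\{k2^{-n}:k\in\mathbb Z\}$. Algorithms do not access $\iota$ but an oracle representation $\tilde\iota$ of $\iota$: for each coordinate $f_j(\iota)$ of $(y,A)$ and each $n\in\mathbb N$ a number $f_{j,n}\in\mathbb D_n$ with $|f_{j,n}-f_j(\iota)|\le2^{-n}$. $\tilde\Omega_{m,N}$ is the set of all such representations of all $\iota\in\Omega_{m,N}$. Statements "for all $\iota$" about an algorithm mean for all $\iota$ and all representations $\tilde\iota$ of $\iota$ (so $\Gamma(\iota)$ stands for $\Gamma(m,N,\tilde\iota)$; the algorithm also receives $m,N$); "there exists $\iota$" means there is an $\iota$ and a representation of it. **Algorithms.** Impossibility statements are for (randomised) general algorithms. For fixed $m,N$ let $\tilde\Lambda=\{g_1,g_2,\dots\}$ be the countable set of evaluations $\tilde f_{j,n}:\tilde\iota\mapsto f_{j,n}$. A general algorithm is a map $\Gamma:\tilde\Omega_{m,N}\to\{0,1\}\cup\{\mathrm{NH}\}$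 (NH = "not halting") together with nonempty sets $\Lambda_\Gamma(\tilde\iota)\subset\tilde\Lambda$ such that $\Lambda_\Gamma(\tilde\iota)$ is finite if $\Gamma(\tilde\iota)\ne\mathrm{NH}$; $\Gamma(\tilde\iota)$ is determined by $\{f(\tilde\iota)\}_{f\in\Lambda_\Gamma(\tilde\iota)}$; and if $f(\tilde\iota')=f(\tilde\iota)$ for all $f\in\Lambda_\Gamma(\tilde\iota)$ then $\Lambda_\Gamma(\tilde\iota')=\Lambda_\Gamma(\tilde\iota)$. On $\Omega$ an algorithm is a family of such maps indexed by $(m,N)$. An unqualified algorithm never outputs NH. A randomised (general) algorithm is a set $X$ of general algorithms with a $\sigma$-algebra $\mathcal F$ and probability measures $\{\mathbb P_{\tilde\iota}\}$ on $\mathcal F$ such that (P1) $\Gamma\mapsto\Gamma(\tilde\iota)$ is measurable for each $\tilde\iota$; (P2) $\{\Gamma\in X:\sup\{k:g_k\in\Lambda_\Gamma(\tilde\iota)\}\le n\}\in\mathcal F$ for all $n,\tilde\iota$; (P3) if $E\in\mathcal F$ and $f(\tilde\iota_1)=f(\tilde\iota_2)$ for every $\Gamma\in E$ and $f\in\Lambda_\Gamma(\tilde\iota_1)$, then $\mathbb P_{\tilde\iota_1}(E)=\mathbb P_{\tilde\iota_2}(E)$. "With probability exceeding $\mathrm p>1/2$" in (ii): for every $\mathrm p>1/2$ there is no randomised algorithm that is correct with probability at least $\mathrm p$ on every input. In existence statements, algorithms are Turing or BSS machines (real arithmetic) querying the numbers $f_{j,n}$ via an oracle. **Runtime.** $D_\Gamma(\tilde\iota)=\sup\{n:\exists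 j,\ \tilde f_{j,n}\in\Lambda_\Gamma(\tilde\iota)\}$ is the number of digits read; runtime is any measure of runtime with $\mathrm{Runtime}_\Gamma(\tilde\iota)\ge D_\Gamma(\tilde\iota)$. *)

theory Defs
  imports
    "HOL-Probability.Probability"
    "HOL-Computational_Algebra.Polynomial"
    "Jordan_Normal_Form.Matrix"
begin

section \<open>The decision problem\<close>

type_synonym input = "real Matrix.vec \<times> real Matrix.mat"

definition trunc10 :: "nat \<Rightarrow> real \<Rightarrow> real" where
  "trunc10 k t = of_int \<lfloor>10 ^ k * t\<rfloor> / 10 ^ k"

definition Xi :: "real \<Rightarrow> nat \<Rightarrow> input \<Rightarrow> nat" where
  "Xi M k \<iota> = (case \<iota> of (y, A) \<Rightarrow>
     if \<exists>x \<in> carrier_vec (dim_col A).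
          trunc10 k (scalar_prod x (Matrix.vec (dim_col A) (\<lambda>_. 1))) \<le> M \<and>
          A *\<^sub>v x = y \<and> (\<forall>i<dim_col A. 0 \<le> vec_index x i)
     then 1 else 0)"

text \<open>The integer exponent \<open>1 - int k\<close> is \<open>-(k-1)\<close>, also for \<open>k = 0\<close>.\<close>

definition S9 :: "nat \<Rightarrow> real set" where
  "S9 k = (\<Union>n::nat. {(real n + 9/10) * 10 powi (1 - int k) ..< (real n + 1) * 10 powi (1 - int k)})"

text \<open>
  A class of inputs is indexed by the dimensions \<open>(m, N)\<close>; only the pairs in a set \<open>D\<close> of
  dimensions are regarded as belonging to it, so that \<open>D = all_dims\<close> gives
  \<open>\<Omega> = \<Union>m<N. \<Omega> m N\<close> and \<open>D = {(m, N)}\<close> gives a class with fixed dimensions.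
\<close>

type_synonym family = "nat \<Rightarrow> nat \<Rightarrow> input set"

definition all_dims :: "(nat \<times> nat) set" where
  "all_dims = {(m, N). 1 \<le> m \<and> m < N}"

definition input_class :: "(nat \<times> nat) set \<Rightarrow> family \<Rightarrow> bool" where
  "input_class D \<Omega> \<longleftrightarrow>
     (\<forall>(m, N) \<in> D. \<Omega> m N \<noteq> {} \<and> \<Omega> m N \<subseteq> carrier_vec m \<times> carrier_mat m N)"


section \<open>Inexact input\<close>

definition num_vars :: "nat \<Rightarrow> nat \<Rightarrow> nat" where
  "num_vars m N = m + m * N"

text \<open>Coordinates are numbered from \<open>0\<close>: first \<open>y\<close>, then \<open>A\<close> row by row.\<close>

definition coord :: "nat \<Rightarrow> nat \<Rightarrow> input \<Rightarrow> nat \<Rightarrow> real" where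
  "coord m N \<iota> j =
     (if j < m then vec_index (fst \<iota>) j
      else index_mat (snd \<iota>) ((j - m) div N, (j - m) mod N))"

definition dyadics :: "nat \<Rightarrow> real set" where
  "dyadics n = {of_int k / 2 ^ n | k :: int. True}"

type_synonym oracle_rep = "nat \<Rightarrow> nat \<Rightarrow> real"

definition evals :: "nat \<Rightarrow> nat \<Rightarrow> (nat \<times> nat) set" where
  "evals m N = {(j, n). j < num_vars m N \<and> 1 \<le> n}"

text \<open>
  \<open>r j n\<close> is the number \<open>f\<^sub>j\<^sub>,\<^sub>n\<close>. Since HOL functions are total, a representation is given the value \<open>0\<close>
  outside the index set \<open>evals m N\<close>; this carries no information on the input.
\<close>

definition represents :: "nat \<Rightarrow> nat \<Rightarrow> input \<Rightarrow> oracle_rep \<Rightarrow> bool" where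
  "represents m N \<iota> r \<longleftrightarrow>
     (\<forall>(j, n) \<in> evals m N. r j n \<in> dyadics n \<and> \<bar>r j n - coord m N \<iota> j\<bar> \<le> 1 / 2 ^ n) \<and>
     (\<forall>j n. (j, n) \<notin> evals m N \<longrightarrow> r j n = 0)"

definition reps :: "nat \<Rightarrow> nat \<Rightarrow> input set \<Rightarrow> oracle_rep set" where
  "reps m N S = {r. \<exists>\<iota>\<in>S. represents m N \<iota> r}"

text \<open>
  Sets of evaluations are given by index pairs \<open>(j, n)\<close>. The following is the supremum of the
  numbers of digits asked for.
\<close>

definition digits :: "(nat \<times> nat) set \<Rightarrow> enat" where
  "digits L = (SUP (j, n) \<in> L. enat n)"


section \<open>General algorithms\<close>

datatype result = Val (the_val: nat) | NH

record gen_alg =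
  out :: "oracle_rep \<Rightarrow> result"
  lam :: "oracle_rep \<Rightarrow> (nat \<times> nat) set"

definition general_algorithm :: "nat \<Rightarrow> nat \<Rightarrow> input set \<Rightarrow> gen_alg \<Rightarrow> bool" where
  "general_algorithm m N S \<Gamma> \<longleftrightarrow>
     out \<Gamma> \<in> reps m N S \<rightarrow>\<^sub>E {Val 0, Val 1, NH} \<and>
     lam \<Gamma> \<in> reps m N S \<rightarrow>\<^sub>E {L. L \<noteq> {} \<and> L \<subseteq> evals m N} \<and>
     (\<forall>r \<in> reps m N S. out \<Gamma> r \<noteq> NH \<longrightarrow> finite (lam \<Gamma> r)) \<and>
     (\<forall>r \<in> reps m N S. \<forall>r' \<in> reps m N S.
        (\<forall>(j, n) \<in> lam \<Gamma> r. r' j n = r j n) \<longrightarrow> out \<Gamma> r' = out \<Gamma> r \<and> lam \<Gamma> r' = lam \<Gamma> r)"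

definition algorithm_on :: "(nat \<times> nat) set \<Rightarrow> family \<Rightarrow> (nat \<Rightarrow> nat \<Rightarrow> gen_alg) \<Rightarrow> bool" where
  "algorithm_on D \<Omega> \<Gamma> \<longleftrightarrow>
     (\<forall>(m, N) \<in> D. general_algorithm m N (\<Omega> m N) (\<Gamma> m N) \<and>
        (\<forall>r \<in> reps m N (\<Omega> m N). out (\<Gamma> m N) r \<noteq> NH))"

text \<open>
  \<open>eval_index\<close> is the position of \<open>(j, n)\<close> in the enumeration \<open>g\<^sub>1, g\<^sub>2, \<dots>\<close> of \<open>evals m N\<close>
  that lists the evaluations by increasing \<open>n\<close>, and by increasing \<open>j\<close> for equal \<open>n\<close>.
\<close>

definition eval_index :: "nat \<Rightarrow> nat \<Rightarrow> nat \<times> nat \<Rightarrow> nat" where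
  "eval_index m N = (\<lambda>(j, n). (n - 1) * num_vars m N + j + 1)"

record rand_alg =
  algs :: "gen_alg set"
  events :: "gen_alg set set"
  prb :: "oracle_rep \<Rightarrow> gen_alg measure"

definition randomised_algorithm :: "nat \<Rightarrow> nat \<Rightarrow> input set \<Rightarrow> rand_alg \<Rightarrow> bool" where
  "randomised_algorithm m N S G \<longleftrightarrow>
     (\<forall>\<Gamma> \<in> algs G. general_algorithm m N S \<Gamma>) \<and>
     sigma_algebra (algs G) (events G) \<and>
     (\<forall>r \<in> reps m N S. prob_space (prb G r) \<and> space (prb G r) = algs G \<and> sets (prb G r) = events G) \<and>
     (\<forall>r \<in> reps m N S. (\<lambda>\<Gamma>. out \<Gamma> r) \<in> prb G r \<rightarrow>\<^sub>M count_space UNIV) \<and>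
     (\<forall>r \<in> reps m N S. \<forall>n::nat.
        {\<Gamma> \<in> algs G. (SUP e \<in> lam \<Gamma> r. enat (eval_index m N e)) \<le> enat n} \<in> events G) \<and>
     (\<forall>r1 \<in> reps m N S. \<forall>r2 \<in> reps m N S. \<forall>E \<in> events G.
        (\<forall>\<Gamma> \<in> E. \<forall>(j, n) \<in> lam \<Gamma> r1. r1 j n = r2 j n) \<longrightarrow>
        measure (prb G r1) E = measure (prb G r2) E)"

definition randomised_algorithm_on ::
    "(nat \<times> nat) set \<Rightarrow> family \<Rightarrow> (nat \<Rightarrow> nat \<Rightarrow> rand_alg) \<Rightarrow> bool" where
  "randomised_algorithm_on D \<Omega> G \<longleftrightarrow>
     (\<forall>(m, N) \<in> D. randomised_algorithm m N (\<Omega> m N) (G m N))"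


section \<open>Oracle Turing machines\<close>

text \<open>
  Deterministic machines with four two-way infinite tapes. Initially the input tape holds
  \<open>1\<^sup>m # 1\<^sup>N\<close> and the other tapes are blank. When the machine is in its query state and the query
  tape holds exactly \<open>1\<^sup>j # 1\<^sup>n\<close>, the content of the answer tape is replaced, in one step, by the
  integer \<open>k\<close> with \<open>f\<^sub>j\<^sub>,\<^sub>n = k / 2\<^sup>n\<close>, written in binary, and the answer head is put on its first
  symbol. In a query state with any other content of the query tape the machine hangs, that is,
  it never halts.
\<close>

datatype sym = Blank | Zero | One | Minus | Sep
datatype tape = InputT | QueryT | AnswerT | WorkT
datatype dir = MoveL | Stay | MoveR

record tm =
  tm_states :: nat
  tm_start :: nat
  tm_ask :: nat
  tm_resume :: nat
  tm_accept :: nat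
  tm_reject :: nat
  tm_delta :: "nat \<Rightarrow> (tape \<Rightarrow> sym) \<Rightarrow> nat \<times> (tape \<Rightarrow> sym \<times> dir)"

record tm_config =
  state :: nat
  cells :: "tape \<Rightarrow> int \<Rightarrow> sym"
  head :: "tape \<Rightarrow> int"

definition tm_wf :: "tm \<Rightarrow> bool" where
  "tm_wf T \<longleftrightarrow>
     {tm_start T, tm_ask T, tm_resume T, tm_accept T, tm_reject T} \<subseteq> {..<tm_states T} \<and>
     distinct [tm_ask T, tm_accept T, tm_reject T] \<and>
     (\<forall>q < tm_states T. \<forall>a. fst (tm_delta T q a) < tm_states T)"

definition tape_of :: "sym list \<Rightarrow> int \<Rightarrow> sym" where
  "tape_of w = (\<lambda>i. if 0 \<le> i \<and> nat i < length w then w ! nat i else Blank)"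

definition pair_word :: "nat \<Rightarrow> nat \<Rightarrow> sym list" where
  "pair_word a b = replicate a One @ Sep # replicate b One"

text \<open>Binary notation, most significant digit first.\<close>

fun bin_word :: "nat \<Rightarrow> sym list" where
  "bin_word k = (if k < 2 then [] else bin_word (k div 2)) @ [if odd k then One else Zero]"

declare bin_word.simps [simp del]

definition int_word :: "int \<Rightarrow> sym list" where
  "int_word k = (if k < 0 then [Minus] else []) @ bin_word (nat \<bar>k\<bar>)"

definition tm_init :: "tm \<Rightarrow> nat \<Rightarrow> nat \<Rightarrow> tm_config" where
  "tm_init T m N =
     \<lparr> state = tm_start T,
       cells = (\<lambda>d. tape_of (if d = InputT then pair_word m N else [])),
       head = (\<lambda>d. 0) \<rparr>"

text \<open>The set of queries asked in a configuration; it has at most one element.\<close>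

definition tm_queries :: "tm \<Rightarrow> tm_config \<Rightarrow> (nat \<times> nat) set" where
  "tm_queries T c = {(j, n). state c = tm_ask T \<and> cells c QueryT = tape_of (pair_word j n)}"

definition tm_halted :: "tm \<Rightarrow> tm_config \<Rightarrow> bool" where
  "tm_halted T c \<longleftrightarrow> state c \<in> {tm_accept T, tm_reject T}"

definition tm_work_step :: "tm \<Rightarrow> tm_config \<Rightarrow> tm_config" where
  "tm_work_step T c = (let (q, act) = tm_delta T (state c) (\<lambda>d. cells c d (head c d)) in
     \<lparr> state = q,
       cells = (\<lambda>d. (cells c d)(head c d := fst (act d))),
       head = (\<lambda>d. head c d + (case snd (act d) of MoveL \<Rightarrow> -1 | Stay \<Rightarrow> 0 | MoveR \<Rightarrow> 1)) \<rparr>)"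

definition tm_step :: "tm \<Rightarrow> oracle_rep \<Rightarrow> tm_config \<Rightarrow> tm_config" where
  "tm_step T r c =
     (if tm_halted T c then c
      else if state c = tm_ask T then
        (if tm_queries T c = {} then c
         else let (j, n) = the_elem (tm_queries T c) in
           \<lparr> state = tm_resume T,
             cells = (cells c)(AnswerT := tape_of (int_word \<lfloor>r j n * 2 ^ n\<rfloor>)),
             head = (head c)(AnswerT := 0) \<rparr>)
      else tm_work_step T c)"

definition tm_run :: "tm \<Rightarrow> oracle_rep \<Rightarrow> nat \<Rightarrow> nat \<Rightarrow> nat \<Rightarrow> tm_config" where
  "tm_run T r m N t = (tm_step T r ^^ t) (tm_init T m N)"

definition tm_halts_with :: "tm \<Rightarrow> oracle_rep \<Rightarrow> nat \<Rightarrow> nat \<Rightarrow> nat \<Rightarrow> nat \<Rightarrow> bool" where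
  "tm_halts_with T r m N t v \<longleftrightarrow>
     state (tm_run T r m N t) = tm_accept T \<and> v = 1 \<or>
     state (tm_run T r m N t) = tm_reject T \<and> v = 0"

definition tm_asked :: "tm \<Rightarrow> oracle_rep \<Rightarrow> nat \<Rightarrow> nat \<Rightarrow> nat \<Rightarrow> (nat \<times> nat) set" where
  "tm_asked T r m N t = (\<Union>s\<le>t. tm_queries T (tm_run T r m N s))"

text \<open>
  Every cell that is ever scanned or nonblank is charged, including the input and the query
  answers; in a finite run these are finitely many.
\<close>

definition tm_space :: "tm \<Rightarrow> oracle_rep \<Rightarrow> nat \<Rightarrow> nat \<Rightarrow> nat \<Rightarrow> nat" where
  "tm_space T r m N t =
     card {(d, i). \<exists>s\<le>t. head (tm_run T r m N s) d = i \<or> cells (tm_run T r m N s) d i \<noteq> Blank}"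


section \<open>Oracle BSS machines\<close>

text \<open>
  Uniform BSS machines over the reals, with a bi-infinite sequence of real cells as state
  space, arithmetic nodes, branch nodes testing \<open>x\<^sub>i \<ge> 0\<close>, and shift nodes. Initially cells 0 and 1
  hold \<open>m\<close> and \<open>N\<close> and all others hold 0. \<open>Ask d a b\<close> puts \<open>f\<^sub>j\<^sub>,\<^sub>n\<close> into cell \<open>d\<close>, where \<open>j\<close> and \<open>n\<close>
  are the contents of \<open>a\<close> and \<open>b\<close>. A machine that divides by 0, asks with a cell that is not a
  natural number, or leaves its program hangs, that is, it never halts.
\<close>

datatype bss_instr =
    Const int real
  | Add int int int
  | Sub int int int
  | Mul int int int
  | Div int int int
  | Branch int nat
  | ShiftL
  | ShiftR
  | Ask int int int
  | Output int

type_synonym bss = "bss_instr list"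
type_synonym bss_config = "nat \<times> (int \<Rightarrow> real)"

definition bss_init :: "nat \<Rightarrow> nat \<Rightarrow> bss_config" where
  "bss_init m N = (0, (\<lambda>_. 0)(0 := real m, 1 := real N))"

definition bss_step :: "bss \<Rightarrow> oracle_rep \<Rightarrow> bss_config \<Rightarrow> bss_config" where
  "bss_step P r = (\<lambda>(pc, s).
     if length P \<le> pc then (pc, s) else
     (case P ! pc of
        Const d c \<Rightarrow> (pc + 1, s(d := c))
      | Add d a b \<Rightarrow> (pc + 1, s(d := s a + s b))
      | Sub d a b \<Rightarrow> (pc + 1, s(d := s a - s b))
      | Mul d a b \<Rightarrow> (pc + 1, s(d := s a * s b))
      | Div d a b \<Rightarrow> if s b = 0 then (pc, s) else (pc + 1, s(d := s a / s b))
      | Branch a l \<Rightarrow> if 0 \<le> s a then (l, s) else (pc + 1, s)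
      | ShiftL \<Rightarrow> (pc + 1, \<lambda>i. s (i + 1))
      | ShiftR \<Rightarrow> (pc + 1, \<lambda>i. s (i - 1))
      | Ask d a b \<Rightarrow>
          if s a \<in> \<nat> \<and> s b \<in> \<nat> then (pc + 1, s(d := r (nat \<lfloor>s a\<rfloor>) (nat \<lfloor>s b\<rfloor>))) else (pc, s)
      | Output a \<Rightarrow> (pc, s)))"

definition bss_run :: "bss \<Rightarrow> oracle_rep \<Rightarrow> nat \<Rightarrow> nat \<Rightarrow> nat \<Rightarrow> bss_config" where
  "bss_run P r m N t = (bss_step P r ^^ t) (bss_init m N)"

definition bss_halts_with :: "bss \<Rightarrow> oracle_rep \<Rightarrow> nat \<Rightarrow> nat \<Rightarrow> nat \<Rightarrow> nat \<Rightarrow> bool" where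
  "bss_halts_with P r m N t v \<longleftrightarrow>
     (case bss_run P r m N t of (pc, s) \<Rightarrow>
        pc < length P \<and> (\<exists>a. P ! pc = Output a \<and> s a = real v))"

definition bss_queries :: "bss \<Rightarrow> bss_config \<Rightarrow> (nat \<times> nat) set" where
  "bss_queries P = (\<lambda>(pc, s).
     {(j, n). pc < length P \<and> (\<exists>d a b. P ! pc = Ask d a b \<and> s a = real j \<and> s b = real n)})"

definition bss_asked :: "bss \<Rightarrow> oracle_rep \<Rightarrow> nat \<Rightarrow> nat \<Rightarrow> nat \<Rightarrow> (nat \<times> nat) set" where
  "bss_asked P r m N t = (\<Union>s\<le>t. bss_queries P (bss_run P r m N s))"


section \<open>Solvability notions\<close>

text \<open>
  In all of the following, \<open>\<Xi>\<close> is the map to be computed, and a statement about an input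
  quantifies over the representations \<open>r\<close> of the input as well.
\<close>

text \<open>The limit is taken in the discrete space \<^typ>\<open>nat\<close>.\<close>

definition solvable_in_limit_from_below ::
    "(nat \<times> nat) set \<Rightarrow> family \<Rightarrow> (input \<Rightarrow> nat) \<Rightarrow> bool" where
  "solvable_in_limit_from_below D \<Omega> \<Xi> \<longleftrightarrow>
     (\<exists>\<Gamma> :: nat \<Rightarrow> nat \<Rightarrow> nat \<Rightarrow> gen_alg.
        (\<forall>i. algorithm_on D \<Omega> (\<Gamma> i)) \<and>
        (\<forall>(m, N) \<in> D. \<forall>\<iota> \<in> \<Omega> m N. \<forall>r. represents m N \<iota> r \<longrightarrow>
           (\<lambda>i. the_val (out (\<Gamma> i m N) r)) \<longlonglongrightarrow> \<Xi> \<iota> \<and>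
           (\<forall>i. out (\<Gamma> i m N) r = Val 1 \<longrightarrow> \<Xi> \<iota> = 1)))"

definition solvable_with_probability ::
    "(nat \<times> nat) set \<Rightarrow> family \<Rightarrow> (input \<Rightarrow> nat) \<Rightarrow> real \<Rightarrow> bool" where
  "solvable_with_probability D \<Omega> \<Xi> p \<longleftrightarrow>
     (\<exists>G. randomised_algorithm_on D \<Omega> G \<and>
        (\<forall>(m, N) \<in> D. \<forall>\<iota> \<in> \<Omega> m N. \<forall>r. represents m N \<iota> r \<longrightarrow>
           p \<le> measure (prb (G m N) r) {\<Gamma> \<in> algs (G m N). out \<Gamma> r = Val (\<Xi> \<iota>)}))"

definition tm_computes :: "(nat \<times> nat) set \<Rightarrow> family \<Rightarrow> (input \<Rightarrow> nat) \<Rightarrow> tm \<Rightarrow> bool" where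
  "tm_computes D \<Omega> \<Xi> T \<longleftrightarrow> tm_wf T \<and>
     (\<forall>(m, N) \<in> D. \<forall>\<iota> \<in> \<Omega> m N. \<forall>r. represents m N \<iota> r \<longrightarrow>
        (\<exists>t. tm_halts_with T r m N t (\<Xi> \<iota>)))"

definition bss_computes :: "(nat \<times> nat) set \<Rightarrow> family \<Rightarrow> (input \<Rightarrow> nat) \<Rightarrow> bss \<Rightarrow> bool" where
  "bss_computes D \<Omega> \<Xi> P \<longleftrightarrow>
     (\<forall>(m, N) \<in> D. \<forall>\<iota> \<in> \<Omega> m N. \<forall>r. represents m N \<iota> r \<longrightarrow>
        (\<exists>t. bss_halts_with P r m N t (\<Xi> \<iota>)))"

text \<open>\<open>rt\<close> is an arbitrary measure of runtime, possibly infinite, that dominates the digits read.\<close>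

definition needs_arbitrarily_long ::
    "(nat \<times> nat) set \<Rightarrow> family \<Rightarrow> (input \<Rightarrow> nat) \<Rightarrow> bool" where
  "needs_arbitrarily_long D \<Omega> \<Xi> \<longleftrightarrow>
     (\<forall>(m, N) \<in> D. \<forall>T > 0. \<forall>\<Gamma>. \<forall>rt :: oracle_rep \<Rightarrow> ereal.
        algorithm_on D \<Omega> \<Gamma> \<longrightarrow>
        (\<forall>r \<in> reps m N (\<Omega> m N). ereal_of_enat (digits (lam (\<Gamma> m N) r)) \<le> rt r) \<longrightarrow>
        (\<exists>\<iota> \<in> \<Omega> m N. \<exists>r. represents m N \<iota> r \<and>
           (out (\<Gamma> m N) r \<noteq> Val (\<Xi> \<iota>) \<or> ereal T < rt r)))"

text \<open>
  Here the runtime \<open>rt\<close> has to be measurable for the probability to make sense.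
\<close>

definition needs_arbitrarily_long_randomised ::
    "(nat \<times> nat) set \<Rightarrow> family \<Rightarrow> (input \<Rightarrow> nat) \<Rightarrow> bool" where
  "needs_arbitrarily_long_randomised D \<Omega> \<Xi> \<longleftrightarrow>
     (\<forall>(m, N) \<in> D. \<forall>T > 0. \<forall>G. \<forall>p \<in> {0<..<1/2::real}. \<forall>rt :: gen_alg \<Rightarrow> oracle_rep \<Rightarrow> ereal.
        randomised_algorithm_on D \<Omega> G \<longrightarrow>
        (\<forall>r \<in> reps m N (\<Omega> m N).
           (\<lambda>\<Gamma>. rt \<Gamma> r) \<in> borel_measurable (prb (G m N) r) \<and>
           (\<forall>\<Gamma> \<in> algs (G m N). ereal_of_enat (digits (lam \<Gamma> r)) \<le> rt \<Gamma> r)) \<longrightarrow>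
        (\<exists>\<iota> \<in> \<Omega> m N. \<exists>r. represents m N \<iota> r \<and>
           p < measure (prb (G m N) r)
                 {\<Gamma> \<in> algs (G m N). out \<Gamma> r \<noteq> Val (\<Xi> \<iota>) \<or> ereal T < rt \<Gamma> r}))"

text \<open>
  For both machine models every elementary step is charged as one operation. The machines are
  at rest after halting, so the bounds at a halting time \<open>t\<close> are bounds for the whole run.
\<close>

definition polynomially_solvable ::
    "(nat \<times> nat) set \<Rightarrow> family \<Rightarrow> (input \<Rightarrow> nat) \<Rightarrow> bool" where
  "polynomially_solvable D \<Omega> \<Xi> \<longleftrightarrow>
     (\<exists>(pol :: real poly) T P. tm_wf T \<and>
        (\<forall>(m, N) \<in> D. \<forall>\<iota> \<in> \<Omega> m N. \<forall>r. represents m N \<iota> r \<longrightarrow>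
           (\<exists>t. tm_halts_with T r m N t (\<Xi> \<iota>) \<and>
              real t \<le> poly pol (real (num_vars m N)) \<and>
              ereal_of_enat (digits (tm_asked T r m N t)) \<le> ereal (poly pol (ln (real (num_vars m N)))) \<and>
              real (tm_space T r m N t) \<le> poly pol (real (num_vars m N))) \<and>
           (\<exists>t. bss_halts_with P r m N t (\<Xi> \<iota>) \<and>
              real t \<le> poly pol (real (num_vars m N)) \<and>
              ereal_of_enat (digits (bss_asked P r m N t)) \<le> ereal (poly pol (ln (real (num_vars m N)))))))"

definition computable_but_long ::
    "(nat \<times> nat) set \<Rightarrow> family \<Rightarrow> (input \<Rightarrow> nat) \<Rightarrow> bool" where
  "computable_but_long D \<Omega> \<Xi> \<longleftrightarrow>
     (\<exists>T. tm_computes D \<Omega> \<Xi> T) \<and> (\<exists>P. bss_computes D \<Omega> \<Xi> P) \<and>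
     needs_arbitrarily_long D \<Omega> \<Xi> \<and>
     needs_arbitrarily_long_randomised D \<Omega> \<Xi>"

end

theory Submission
  imports Defs
begin

text \<open>
  \<open>Xi M k\<close> is \<open>1\<close> iff the least total of a solution lies below \<open>u\<^sub>k\<close>, the least multiple of
  \<open>10\<close> to the power \<open>-k\<close> exceeding \<open>M\<close>; here \<open>u\<^sub>k < u\<^sub>k\<^sub>-\<^sub>1\<close> unless the \<open>k\<close>-th digit of \<open>M\<close> is \<open>9\<close>.
  All inputs are essentially one equation \<open>a x\<^sub>0 + b x\<^sub>1 = c\<close>. In the class the minimum takes the
  values \<open>0\<close>, \<open>u\<^sub>K\<close> and \<open>u\<^sub>K\<^sub>-\<^sub>1\<close>. It jumps from \<open>u\<^sub>K\<close> to \<open>0\<close> at a limit point in the class, which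
  defeats every algorithm for level \<open>K\<close>. At level \<open>K - 1\<close> the answer is the sign of the nonzero
  coefficient \<open>a\<close>, which is found by reading digits but needs arbitrarily many of them. At level
  \<open>K - 2\<close> the answer is constantly \<open>1\<close>.
\<close>

section \<open>Indistinguishable inputs\<close>

lemma general_algorithm_transfer:
  assumes "general_algorithm m N S \<Gamma>" "r \<in> reps m N S" "r' \<in> reps m N S"
    and "\<And>j n. (j, n) \<in> lam \<Gamma> r \<Longrightarrow> r' j n = r j n"
  shows "out \<Gamma> r' = out \<Gamma> r"
  using assms unfolding general_algorithm_def by fast

lemma general_algorithmD:
  assumes "general_algorithm m N S \<Gamma>" "r \<in> reps m N S"
  shows "lam \<Gamma> r \<subseteq> evals m N" "out \<Gamma> r \<noteq> NH \<Longrightarrow> finite (lam \<Gamma> r)"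
  using assms unfolding general_algorithm_def by (blast dest: PiE_mem)+

lemma finite_index_pairs_bounded:
  assumes "finite (L :: (nat \<times> nat) set)"
  obtains T where "\<And>j n. (j, n) \<in> L \<Longrightarrow> n \<le> T"
proof
  show "n \<le> Max (snd ` L)" if "(j, n) \<in> L" for j n
    using assms that by (intro Max_ge) (auto simp: image_iff intro: bexI[of _ "(j, n)"])
qed

lemma digits_le_imp:
  assumes "ereal_of_enat (digits L) \<le> ereal T" "(j, n) \<in> L"
  shows "n \<le> nat \<lfloor>T\<rfloor>"
proof -
  have "enat n \<le> digits L"
    unfolding digits_def using assms(2) by (intro SUP_upper2[of "(j, n)"]) auto
  then have "ereal_of_enat (enat n) \<le> ereal T"
    using assms(1) by (meson ereal_of_enat_le_iff order_trans)
  then show ?thesis by (simp add: le_nat_floor)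
qed

text \<open>At \<open>r0\<close> some member of the sequence outputs 1 after reading finitely many
  digits. An input whose answer is not 1 but which agrees on those digits forces the same 1, against
  the one-sided error.\<close>

lemma not_solvable_in_limit_from_below:
  assumes D: "(m, N) \<in> D" and \<iota>0: "\<iota>0 \<in> \<Omega> m N" "represents m N \<iota>0 r0" "\<Xi> \<iota>0 = 1"
    and near: "\<And>T. \<exists>\<iota>\<in>\<Omega> m N. \<exists>r. represents m N \<iota> r \<and> \<Xi> \<iota> \<noteq> 1 \<and> (\<forall>j. \<forall>n\<le>T. r j n = r0 j n)"
  shows "\<not> solvable_in_limit_from_below D \<Omega> \<Xi>"
proof
  assume "solvable_in_limit_from_below D \<Omega> \<Xi>"
  then obtain \<Gamma> where alg: "\<And>i. algorithm_on D \<Omega> (\<Gamma> i)"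
    and lim: "\<And>\<iota> r. \<iota> \<in> \<Omega> m N \<Longrightarrow> represents m N \<iota> r \<Longrightarrow> (\<lambda>i. the_val (out (\<Gamma> i m N) r)) \<longlonglongrightarrow> \<Xi> \<iota>"
    and below: "\<And>\<iota> r i. \<iota> \<in> \<Omega> m N \<Longrightarrow> represents m N \<iota> r \<Longrightarrow> out (\<Gamma> i m N) r = Val 1 \<Longrightarrow> \<Xi> \<iota> = 1"
    unfolding solvable_in_limit_from_below_def using D by fast
  have r0: "r0 \<in> reps m N (\<Omega> m N)" using \<iota>0 by (auto simp: reps_def)
  have "\<forall>\<^sub>F i in sequentially. the_val (out (\<Gamma> i m N) r0) = 1"
    using lim[OF \<iota>0(1,2)] \<iota>0(3) by (simp add: tendsto_discrete)
  then obtain i where i: "the_val (out (\<Gamma> i m N) r0) = 1"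
    by (auto simp: eventually_sequentially)
  have ga: "general_algorithm m N (\<Omega> m N) (\<Gamma> i m N)" and NH: "out (\<Gamma> i m N) r0 \<noteq> NH"
    using alg[of i] D r0 unfolding algorithm_on_def by auto
  \<comment> \<open>\<open>the_val NH\<close> is an unspecified number, so the value 1 yields the
    output \<open>Val 1\<close> only because \<open>NH\<close> has been excluded.\<close>
  have out: "out (\<Gamma> i m N) r0 = Val 1"
    using i NH by (cases "out (\<Gamma> i m N) r0") auto
  have "finite (lam (\<Gamma> i m N) r0)"
    using general_algorithmD(2)[OF ga r0 NH] .
  then obtain T where T: "\<And>j n. (j, n) \<in> lam (\<Gamma> i m N) r0 \<Longrightarrow> n \<le> T"
    using finite_index_pairs_bounded by blast
  obtain \<iota> r where \<iota>: "\<iota> \<in> \<Omega> m N" "represents m N \<iota> r" "\<Xi> \<iota> \<noteq> 1" "\<forall>j. \<forall>n\<le>T. r j n = r0 j n"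
    using near by blast
  have "out (\<Gamma> i m N) r = Val 1"
    using general_algorithm_transfer[OF ga r0, of r] \<iota> T out by (auto simp: reps_def)
  then show False using below \<iota> by blast
qed

section \<open>Randomised algorithms\<close>

lemma randomised_algorithmD:
  assumes "randomised_algorithm m N S G" "r \<in> reps m N S"
  shows "prob_space (prb G r)" "space (prb G r) = algs G" "sets (prb G r) = events G"
    "{\<Gamma> \<in> algs G. out \<Gamma> r = v} \<in> events G"
    "{\<Gamma> \<in> algs G. (SUP e \<in> lam \<Gamma> r. enat (eval_index m N e)) \<le> enat n} \<in> events G"
    "\<Gamma> \<in> algs G \<Longrightarrow> general_algorithm m N S \<Gamma>"
proof -
  show *: "prob_space (prb G r)" "space (prb G r) = algs G" "sets (prb G r) = events G"
    "{\<Gamma> \<in> algs G. (SUP e \<in> lam \<Gamma> r. enat (eval_index m N e)) \<le> enat n} \<in> events G"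
    "\<Gamma> \<in> algs G \<Longrightarrow> general_algorithm m N S \<Gamma>"
    using assms unfolding randomised_algorithm_def by auto
  have "(\<lambda>\<Gamma>. out \<Gamma> r) \<in> prb G r \<rightarrow>\<^sub>M count_space UNIV"
    using assms unfolding randomised_algorithm_def by auto
  then have "(\<lambda>\<Gamma>. out \<Gamma> r) -` {v} \<inter> space (prb G r) \<in> sets (prb G r)"
    by (rule measurable_sets) auto
  moreover have "(\<lambda>\<Gamma>. out \<Gamma> r) -` {v} \<inter> algs G = {\<Gamma> \<in> algs G. out \<Gamma> r = v}" by auto
  ultimately show "{\<Gamma> \<in> algs G. out \<Gamma> r = v} \<in> events G" using * by simp
qed

text \<open>Condition (P3) transfers the probability of \<open>E\<close>, while determinism of each
  single member of \<open>E\<close> transfers the output.\<close>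

lemma randomised_algorithm_transfer:
  assumes G: "randomised_algorithm m N S G" and r: "r \<in> reps m N S" "r' \<in> reps m N S"
    and E: "E \<in> events G" "\<And>\<Gamma>. \<Gamma> \<in> E \<Longrightarrow> out \<Gamma> r = v"
    and agree: "\<And>\<Gamma> j n. \<Gamma> \<in> E \<Longrightarrow> (j, n) \<in> lam \<Gamma> r \<Longrightarrow> r' j n = r j n"
  shows "measure (prb G r') E = measure (prb G r) E" "E \<subseteq> {\<Gamma> \<in> algs G. out \<Gamma> r' = v}"
proof -
  have "\<forall>\<Gamma>\<in>E. \<forall>(j, n)\<in>lam \<Gamma> r. r j n = r' j n"
    using agree by fastforce
  moreover have "\<forall>r1\<in>reps m N S. \<forall>r2\<in>reps m N S. \<forall>E\<in>events G.
      (\<forall>\<Gamma>\<in>E. \<forall>(j, n)\<in>lam \<Gamma> r1. r1 j n = r2 j n) \<longrightarrow> measure (prb G r1) E = measure (prb G r2) E"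
    using G unfolding randomised_algorithm_def by (elim conjE)
  ultimately have "measure (prb G r) E = measure (prb G r') E"
    using r E(1) by blast
  then show "measure (prb G r') E = measure (prb G r) E" ..
  have sub: "E \<subseteq> algs G"
    using randomised_algorithmD(2,3)[OF G r(1)] E(1) sets.sets_into_space by metis
  show "E \<subseteq> {\<Gamma> \<in> algs G. out \<Gamma> r' = v}"
  proof
    fix \<Gamma> assume \<Gamma>: "\<Gamma> \<in> E"
    have "out \<Gamma> r' = out \<Gamma> r"
      using sub \<Gamma> agree[OF \<Gamma>]
      by (intro general_algorithm_transfer[OF randomised_algorithmD(6)[OF G r(1)] r]) auto
    then show "\<Gamma> \<in> {\<Gamma> \<in> algs G. out \<Gamma> r' = v}" using \<Gamma> sub E(2) by auto
  qed
qed

text \<open>The enumeration exhausts one precision before the next, so a bound on positions, as in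
  (P2), also bounds the digits read.\<close>

lemma le_eval_index:
  assumes "(j, n) \<in> evals m N"
  shows "n \<le> eval_index m N (j, n)"
proof -
  obtain k where k: "num_vars m N = Suc k"
    using assms by (auto simp: evals_def dest: gr0_implies_Suc[OF order.strict_trans1[OF le0]])
  show ?thesis unfolding eval_index_def k by simp
qed

text \<open>Runs with the right answer at \<open>r0\<close> halt, hence read finitely many digits,
  so a part of them of probability above 1/2 has a common digit bound. On a nearby input with
  another answer this event keeps its probability and consists of wrong runs, which leaves less than
  1/2 for the right ones.\<close>

lemma not_solvable_with_probability:
  assumes D: "(m, N) \<in> D" and \<iota>0: "\<iota>0 \<in> \<Omega> m N" "represents m N \<iota>0 r0" and p: "p > 1/2"
    and near: "\<And>T. \<exists>\<iota>\<in>\<Omega> m N. \<exists>r. represents m N \<iota> r \<and> \<Xi> \<iota> \<noteq> \<Xi> \<iota>0 \<and> (\<forall>j. \<forall>n\<le>T. r j n = r0 j n)"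
  shows "\<not> solvable_with_probability D \<Omega> \<Xi> p"
proof
  assume "solvable_with_probability D \<Omega> \<Xi> p"
  then obtain G' where "randomised_algorithm_on D \<Omega> G'"
    and "\<forall>(m, N) \<in> D. \<forall>\<iota> \<in> \<Omega> m N. \<forall>r. represents m N \<iota> r \<longrightarrow>
      p \<le> measure (prb (G' m N) r) {\<Gamma> \<in> algs (G' m N). out \<Gamma> r = Val (\<Xi> \<iota>)}"
    unfolding solvable_with_probability_def by auto
  then obtain G where G: "randomised_algorithm m N (\<Omega> m N) G"
    and correct: "\<And>\<iota> r. \<iota> \<in> \<Omega> m N \<Longrightarrow> represents m N \<iota> r \<Longrightarrow>
      p \<le> measure (prb G r) {\<Gamma> \<in> algs G. out \<Gamma> r = Val (\<Xi> \<iota>)}"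
    using D unfolding randomised_algorithm_on_def by fast
  have r0: "r0 \<in> reps m N (\<Omega> m N)" using \<iota>0 by (auto simp: reps_def)
  note D0 = randomised_algorithmD[OF G r0]
  interpret P0: prob_space "prb G r0" by (rule D0(1))
  \<comment> \<open>Intersecting with the sets from (P2) keeps \<open>F n\<close> measurable, and
    these sets increase and exhaust the event of right answers, so continuity of measure
    applies.\<close>
  define F where "F = (\<lambda>n::nat. {\<Gamma> \<in> algs G. out \<Gamma> r0 = Val (\<Xi> \<iota>0)} \<inter>
    {\<Gamma> \<in> algs G. (SUP e \<in> lam \<Gamma> r0. enat (eval_index m N e)) \<le> enat n})"
  have F_sets: "F n \<in> events G" for n
    unfolding F_def D0(3)[symmetric] by (intro sets.Int) (simp_all add: D0(3-5))
  have "incseq F" unfolding F_def incseq_def by (auto intro: order_trans)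
  have range_F: "range F \<subseteq> sets (prb G r0)" using F_sets D0(3) by auto
  have lim: "(\<lambda>n. measure (prb G r0) (F n)) \<longlonglongrightarrow> measure (prb G r0) (\<Union>n. F n)"
    using range_F \<open>incseq F\<close> by (rule P0.finite_Lim_measure_incseq)
  have "{\<Gamma> \<in> algs G. out \<Gamma> r0 = Val (\<Xi> \<iota>0)} \<subseteq> (\<Union>n. F n)"
  proof
    fix \<Gamma> assume \<Gamma>: "\<Gamma> \<in> {\<Gamma> \<in> algs G. out \<Gamma> r0 = Val (\<Xi> \<iota>0)}"
    then have "finite (lam \<Gamma> r0)"
      using general_algorithmD(2)[OF D0(6) r0] by auto
    then have "(SUP e \<in> lam \<Gamma> r0. enat (eval_index m N e)) \<le> enat (Max (eval_index m N ` lam \<Gamma> r0))"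
      by (intro SUP_least) auto
    then show "\<Gamma> \<in> (\<Union>n. F n)" using \<Gamma> unfolding F_def by blast
  qed
  then have "p \<le> measure (prb G r0) (\<Union>n. F n)"
    by (intro order_trans[OF correct[OF \<iota>0]] P0.finite_measure_mono sets.countable_UN range_F)
  then have "\<forall>\<^sub>F n in sequentially. 1/2 < measure (prb G r0) (F n)"
    using p by (intro order_tendstoD(1)[OF lim]) auto
  then obtain T where T: "1/2 < measure (prb G r0) (F T)"
    by (auto simp: eventually_sequentially)
  obtain \<iota> r where \<iota>: "\<iota> \<in> \<Omega> m N" "represents m N \<iota> r" "\<Xi> \<iota> \<noteq> \<Xi> \<iota>0" "\<forall>j. \<forall>n\<le>T. r j n = r0 j n"
    using near by blast
  have r: "r \<in> reps m N (\<Omega> m N)" using \<iota> by (auto simp: reps_def)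
  have bound: "n \<le> T" if "\<Gamma> \<in> F T" "(j, n) \<in> lam \<Gamma> r0" for \<Gamma> j n
  proof -
    have "lam \<Gamma> r0 \<subseteq> evals m N"
      using general_algorithmD(1)[OF D0(6) r0] that(1) unfolding F_def by auto
    then have "n \<le> eval_index m N (j, n)" using that(2) by (auto intro: le_eval_index)
    also have "eval_index m N (j, n) \<le> T"
    proof -
      have "enat (eval_index m N (j, n)) \<le> (SUP e \<in> lam \<Gamma> r0. enat (eval_index m N e))"
        using that(2) by (rule SUP_upper)
      also have "\<dots> \<le> enat T" using that(1) by (simp add: F_def)
      finally show ?thesis by simp
    qed
    finally show ?thesis .
  qed
  note tr = randomised_algorithm_transfer[OF G r0 r F_sets[of T], of "Val (\<Xi> \<iota>0)"]
  have eq: "measure (prb G r) (F T) = measure (prb G r0) (F T)"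
    and sub: "F T \<subseteq> {\<Gamma> \<in> algs G. out \<Gamma> r = Val (\<Xi> \<iota>0)}"
    using tr \<iota>(4) bound unfolding F_def by blast+
  note D1 = randomised_algorithmD[OF G r]
  interpret P1: prob_space "prb G r" by (rule D1(1))
  \<comment> \<open>The right runs and \<open>F T\<close> are disjoint because the two answers
    differ; their probabilities would add up to more than 1.\<close>
  define C where "C = {\<Gamma> \<in> algs G. out \<Gamma> r = Val (\<Xi> \<iota>)}"
  have "C \<in> sets (prb G r)" "F T \<in> sets (prb G r)" "C \<inter> F T = {}"
    using D1(3,4) F_sets sub \<iota>(3) by (auto simp: C_def)
  then have "measure (prb G r) (C \<union> F T) = measure (prb G r) C + measure (prb G r) (F T)"
    by (intro P1.finite_measure_Union)
  then have "measure (prb G r) C + measure (prb G r) (F T) \<le> 1"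
    using P1.prob_le_1 by metis
  then show False using correct[OF \<iota>(1,2)] T eq p unfolding C_def by linarith
qed

section \<open>Lower bounds on runtime\<close>

text \<open>An algorithm that is correct within time \<open>T\<close> reads no digit beyond
  \<open>T\<close>, so it cannot separate the two inputs. The pair may vary with \<open>T\<close>:
  no limit point in the class is required, and the map may still be computable.\<close>

lemma needs_arbitrarily_longI:
  assumes close: "\<And>m N T. (m, N) \<in> D \<Longrightarrow> \<exists>\<iota>\<in>\<Omega> m N. \<exists>\<iota>'\<in>\<Omega> m N. \<exists>r r'. represents m N \<iota> r \<and>
      represents m N \<iota>' r' \<and> \<Xi> \<iota> \<noteq> \<Xi> \<iota>' \<and> (\<forall>j. \<forall>n\<le>T. r' j n = r j n)"
  shows "needs_arbitrarily_long D \<Omega> \<Xi>"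
  unfolding needs_arbitrarily_long_def
proof (safe, rule ccontr)
  fix m N \<Gamma> and T :: real and rt :: "oracle_rep \<Rightarrow> ereal"
  assume D: "(m, N) \<in> D" and alg: "algorithm_on D \<Omega> \<Gamma>"
    and rt: "\<forall>r\<in>reps m N (\<Omega> m N). ereal_of_enat (digits (lam (\<Gamma> m N) r)) \<le> rt r"
    and "\<not> (\<exists>\<iota>\<in>\<Omega> m N. \<exists>r. represents m N \<iota> r \<and> (out (\<Gamma> m N) r \<noteq> Val (\<Xi> \<iota>) \<or> ereal T < rt r))"
  then have good: "out (\<Gamma> m N) r = Val (\<Xi> \<iota>)" "rt r \<le> ereal T"
    if "\<iota> \<in> \<Omega> m N" "represents m N \<iota> r" for \<iota> r
    using that by (auto simp: not_less)
  obtain \<iota> \<iota>' r r' where \<iota>: "\<iota> \<in> \<Omega> m N" "represents m N \<iota> r" "\<iota>' \<in> \<Omega> m N" "represents m N \<iota>' r'"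
    "\<Xi> \<iota> \<noteq> \<Xi> \<iota>'" "\<forall>j. \<forall>n\<le>nat \<lfloor>T\<rfloor>. r' j n = r j n"
    using close[OF D, of "nat \<lfloor>T\<rfloor>"] by blast
  have r: "r \<in> reps m N (\<Omega> m N)" "r' \<in> reps m N (\<Omega> m N)" using \<iota> by (auto simp: reps_def)
  have "ereal_of_enat (digits (lam (\<Gamma> m N) r)) \<le> ereal T"
    using rt r(1) good(2)[OF \<iota>(1,2)] order_trans by blast
  then have "out (\<Gamma> m N) r' = out (\<Gamma> m N) r"
    using alg D r \<iota>(6) unfolding algorithm_on_def
    by (intro general_algorithm_transfer[of m N "\<Omega> m N"]) (auto dest: digits_le_imp)
  then show False using good(1)[OF \<iota>(1,2)] good(1)[OF \<iota>(3,4)] \<iota>(5) by simp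
qed

text \<open>Suppose the bad event has probability at most \<open>p\<close> on every input. The runs
  correct within time \<open>T\<close> on \<open>r\<close> then have probability at least
  \<open>1 - p\<close>; they cannot tell \<open>r'\<close> from \<open>r\<close>, so on
  \<open>r'\<close> they are wrong with the same probability. Thus \<open>1 - p\<close> is at most
  \<open>p\<close>, impossible for \<open>p < 1/2\<close>.\<close>

lemma needs_arbitrarily_long_randomisedI:
  assumes close: "\<And>m N T. (m, N) \<in> D \<Longrightarrow> \<exists>\<iota>\<in>\<Omega> m N. \<exists>\<iota>'\<in>\<Omega> m N. \<exists>r r'. represents m N \<iota> r \<and>
      represents m N \<iota>' r' \<and> \<Xi> \<iota> \<noteq> \<Xi> \<iota>' \<and> (\<forall>j. \<forall>n\<le>T. r' j n = r j n)"
  shows "needs_arbitrarily_long_randomised D \<Omega> \<Xi>"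
  unfolding needs_arbitrarily_long_randomised_def
proof (safe, rule ccontr)
  fix m N and G' :: "nat \<Rightarrow> nat \<Rightarrow> rand_alg" and T p :: real and rt :: "gen_alg \<Rightarrow> oracle_rep \<Rightarrow> ereal"
  define G where "G = G' m N"
  define bad where "bad = (\<lambda>\<iota> r. {\<Gamma> \<in> algs G. out \<Gamma> r \<noteq> Val (\<Xi> \<iota>) \<or> ereal T < rt \<Gamma> r})"
  assume D: "(m, N) \<in> D" and p: "p \<in> {0<..<1/2}" and G': "randomised_algorithm_on D \<Omega> G'"
    and rt: "\<forall>r\<in>reps m N (\<Omega> m N). (\<lambda>\<Gamma>. rt \<Gamma> r) \<in> borel_measurable (prb (G' m N) r) \<and>
      (\<forall>\<Gamma>\<in>algs (G' m N). ereal_of_enat (digits (lam \<Gamma> r)) \<le> rt \<Gamma> r)"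
    and "\<not> (\<exists>\<iota>\<in>\<Omega> m N. \<exists>r. represents m N \<iota> r \<and>
      p < measure (prb (G' m N) r) {\<Gamma> \<in> algs (G' m N). out \<Gamma> r \<noteq> Val (\<Xi> \<iota>) \<or> ereal T < rt \<Gamma> r})"
  then have bad_le: "measure (prb G r) (bad \<iota> r) \<le> p" if "\<iota> \<in> \<Omega> m N" "represents m N \<iota> r" for \<iota> r
    using that unfolding bad_def G_def by (auto simp: not_less)
  have G: "randomised_algorithm m N (\<Omega> m N) G"
    using G' D unfolding randomised_algorithm_on_def G_def by auto
  \<comment> \<open>Measurability of wrong outputs comes from (P1), that of overtime from the
    assumption on \<open>rt\<close>.\<close>
  have bad_sets: "bad \<iota> r \<in> events G" if r: "r \<in> reps m N (\<Omega> m N)" for \<iota> r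
  proof -
    note D = randomised_algorithmD[OF G r]
    have "(\<lambda>\<Gamma>. rt \<Gamma> r) \<in> borel_measurable (prb G r)" using rt r unfolding G_def by blast
    then have "{\<Gamma> \<in> space (prb G r). ereal T < rt \<Gamma> r} \<in> sets (prb G r)" by measurable
    moreover have "space (prb G r) - {\<Gamma> \<in> algs G. out \<Gamma> r = Val (\<Xi> \<iota>)} \<in> sets (prb G r)"
      using D(3,4) by (intro sets.Diff sets.top) simp
    ultimately have "(algs G - {\<Gamma> \<in> algs G. out \<Gamma> r = Val (\<Xi> \<iota>)}) \<union> {\<Gamma> \<in> algs G. ereal T < rt \<Gamma> r} \<in> sets (prb G r)"
      unfolding D(2) by (rule sets.Un[rotated])
    moreover have "(algs G - {\<Gamma> \<in> algs G. out \<Gamma> r = Val (\<Xi> \<iota>)}) \<union> {\<Gamma> \<in> algs G. ereal T < rt \<Gamma> r} = bad \<iota> r"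
      unfolding bad_def by auto
    ultimately show ?thesis using D(3) by simp
  qed
  obtain \<iota> \<iota>' r r' where \<iota>: "\<iota> \<in> \<Omega> m N" "represents m N \<iota> r" "\<iota>' \<in> \<Omega> m N" "represents m N \<iota>' r'"
    "\<Xi> \<iota> \<noteq> \<Xi> \<iota>'" "\<forall>j. \<forall>n\<le>nat \<lfloor>T\<rfloor>. r' j n = r j n"
    using close[OF D, of "nat \<lfloor>T\<rfloor>"] by blast
  have r: "r \<in> reps m N (\<Omega> m N)" "r' \<in> reps m N (\<Omega> m N)" using \<iota> by (auto simp: reps_def)
  note Dr = randomised_algorithmD[OF G r(1)] and Dr' = randomised_algorithmD[OF G r(2)]
  interpret P: prob_space "prb G r" by (rule Dr(1))
  interpret P': prob_space "prb G r'" by (rule Dr'(1))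
  define E where "E = algs G - bad \<iota> r"
  have E: "E \<in> events G"
    using bad_sets[OF r(1), of \<iota>] Dr(2,3) unfolding E_def by (metis sets.compl_sets)
  have "measure (prb G r) E = 1 - measure (prb G r) (bad \<iota> r)"
    using P.prob_compl[of "bad \<iota> r"] bad_sets[OF r(1)] Dr(2,3) unfolding E_def by simp
  then have E_ge: "1 - p \<le> measure (prb G r) E" using bad_le[OF \<iota>(1,2)] by simp
  have read: "n \<le> nat \<lfloor>T\<rfloor>" if "\<Gamma> \<in> E" "(j, n) \<in> lam \<Gamma> r" for \<Gamma> j n
  proof -
    have "ereal_of_enat (digits (lam \<Gamma> r)) \<le> rt \<Gamma> r" "rt \<Gamma> r \<le> ereal T"
      using that(1) rt r(1) unfolding E_def bad_def G_def by (auto simp: not_less)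
    then show ?thesis using that(2) digits_le_imp order_trans by blast
  qed
  have outE: "out \<Gamma> r = Val (\<Xi> \<iota>)" if "\<Gamma> \<in> E" for \<Gamma> using that unfolding E_def bad_def by auto
  have agree: "r' j n = r j n" if "\<Gamma> \<in> E" "(j, n) \<in> lam \<Gamma> r" for \<Gamma> j n
    using read[OF that] \<iota>(6) by blast
  note tr = randomised_algorithm_transfer[OF G r E, of "Val (\<Xi> \<iota>)"]
  have eq: "measure (prb G r') E = measure (prb G r) E"
    and sub: "E \<subseteq> {\<Gamma> \<in> algs G. out \<Gamma> r' = Val (\<Xi> \<iota>)}"
    using tr outE agree by blast+
  have "measure (prb G r') E \<le> measure (prb G r') (bad \<iota>' r')"
    using sub \<iota>(5) bad_sets[OF r(2), of \<iota>'] Dr'(3)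
    by (intro P'.finite_measure_mono) (auto simp: bad_def)
  then show False using eq E_ge bad_le[OF \<iota>(3,4)] p by auto
qed


section \<open>Oracle representations\<close>

text \<open>The answers up to precision \<open>T\<close> depend on the input only through
  \<open>z\<close>, so all inputs close to the integer point \<open>z\<close> can share them;
  integers lie in every dyadic grid.\<close>

definition near_rep :: "nat \<Rightarrow> nat \<Rightarrow> (nat \<Rightarrow> int) \<Rightarrow> nat \<Rightarrow> input \<Rightarrow> oracle_rep" where
  "near_rep m N z T \<iota> j n =
     (if (j, n) \<notin> evals m N then 0
      else if n \<le> T then of_int (z j)
      else of_int \<lfloor>coord m N \<iota> j * 2 ^ n\<rfloor> / 2 ^ n)"

lemma represents_near_rep:
  assumes "\<And>j. j < num_vars m N \<Longrightarrow> \<bar>of_int (z j) - coord m N \<iota> j\<bar> \<le> 1 / 2 ^ T"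
  shows "represents m N \<iota> (near_rep m N z T \<iota>)"
  unfolding represents_def
proof (intro conjI ballI allI impI; clarify?)
  fix j n assume jn: "(j, n) \<in> evals m N"
  show "near_rep m N z T \<iota> j n \<in> dyadics n \<and> \<bar>near_rep m N z T \<iota> j n - coord m N \<iota> j\<bar> \<le> 1 / 2 ^ n"
  proof (cases "n \<le> T")
    case True
    have "of_int (z j) = of_int (z j * 2 ^ n) / (2::real) ^ n" by simp
    then have "of_int (z j) \<in> dyadics n" unfolding dyadics_def by blast
    moreover have "1 / 2 ^ T \<le> (1::real) / 2 ^ n"
      using True by (intro divide_left_mono power_increasing) auto
    ultimately show ?thesis
      using assms[of j] jn True by (auto simp: near_rep_def evals_def)
  next
    case False
    have "\<bar>of_int \<lfloor>coord m N \<iota> j * 2 ^ n\<rfloor> - coord m N \<iota> j * 2 ^ n\<bar> \<le> 1" by linarith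
    then have "\<bar>(of_int \<lfloor>coord m N \<iota> j * 2 ^ n\<rfloor> - coord m N \<iota> j * 2 ^ n) / 2 ^ n\<bar> \<le> 1 / 2 ^ n"
      by (simp add: abs_divide divide_right_mono)
    then show ?thesis using False jn
      by (auto simp: near_rep_def dyadics_def diff_divide_distrib)
  qed
qed (auto simp: near_rep_def)

lemma near_rep_agree:
  "n \<le> T \<Longrightarrow> near_rep m N z T \<iota> j n = (if (j, n) \<in> evals m N then of_int (z j) else 0)"
  by (simp add: near_rep_def)

lemma represents_integral:
  assumes "\<And>j. j < num_vars m N \<Longrightarrow> coord m N \<iota> j = of_int (z j)"
  shows "represents m N \<iota> (\<lambda>j n. if (j, n) \<in> evals m N then of_int (z j) else 0)"
proof -
  have "of_int (z j) = of_int (z j * 2 ^ n) / (2::real) ^ n" for j n by simp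
  then have "of_int (z j) \<in> dyadics n" for j n unfolding dyadics_def by blast
  then show ?thesis using assms by (auto simp: represents_def evals_def)
qed

text \<open>A nonzero element of the grid of mesh \<open>1 / 2 ^ n\<close> has modulus at least the
  permitted error, so its sign cannot contradict that of the coordinate.\<close>

lemma represents_sign:
  assumes r: "represents m N \<iota> r" and jn: "(j, n) \<in> evals m N"
  shows "0 < r j n \<Longrightarrow> 0 \<le> coord m N \<iota> j" "r j n < 0 \<Longrightarrow> coord m N \<iota> j \<le> 0"
proof -
  obtain k :: int where k: "r j n = of_int k / 2 ^ n" and le: "\<bar>r j n - coord m N \<iota> j\<bar> \<le> 1 / 2 ^ n"
    using r jn unfolding represents_def dyadics_def by fastforce
  show "0 \<le> coord m N \<iota> j" if "0 < r j n"
  proof -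
    have "1 \<le> k" using that k by (simp add: zero_less_divide_iff)
    then have "1 / 2 ^ n \<le> r j n" unfolding k by (intro divide_right_mono) auto
    then show ?thesis using le by linarith
  qed
  show "coord m N \<iota> j \<le> 0" if "r j n < 0"
  proof -
    have "k \<le> - 1" using that k by (simp add: divide_less_0_iff)
    then have "r j n \<le> (- 1) / 2 ^ n" unfolding k by (intro divide_right_mono) auto
    then show ?thesis using le by (simp add: minus_divide_left[symmetric])
  qed
qed

lemma represents_eventually_nonzero:
  assumes "represents m N \<iota> r" "j < num_vars m N" "coord m N \<iota> j \<noteq> 0"
  shows "\<exists>n\<ge>1. r j n \<noteq> 0"
proof -
  obtain n where n: "1 / 2 ^ n < \<bar>coord m N \<iota> j\<bar>"
    using real_arch_pow_inv[of "\<bar>coord m N \<iota> j\<bar>" "1/2"] assms(3) by (auto simp: power_one_over)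
  \<comment> \<open>The exponent \<open>n\<close> found above may be 0, whereas evaluations start at
    precision 1; hence the passage to \<open>Suc n\<close>.\<close>
  have "1 / 2 ^ Suc n \<le> (1::real) / 2 ^ n"
    by (intro divide_left_mono) auto
  moreover have "(j, Suc n) \<in> evals m N" using assms(2) by (simp add: evals_def)
  then have "\<bar>r j (Suc n) - coord m N \<iota> j\<bar> \<le> 1 / 2 ^ Suc n"
    using assms(1) unfolding represents_def by blast
  ultimately have "r j (Suc n) \<noteq> 0" using n by auto
  then show ?thesis by (intro exI[of _ "Suc n"]) auto
qed


section \<open>The class of inputs\<close>

definition threshold :: "real \<Rightarrow> nat \<Rightarrow> real" where
  "threshold M k = (of_int \<lfloor>10 ^ k * M\<rfloor> + 1) / 10 ^ k"

text \<open>Truncation turns the non-strict bound by \<open>M\<close> into a strict bound; this is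
  why a minimum equal to the threshold gets the answer 0.\<close>

lemma trunc10_le_iff: "trunc10 k t \<le> M \<longleftrightarrow> t < threshold M k"
proof -
  have "trunc10 k t \<le> M \<longleftrightarrow> of_int \<lfloor>10 ^ k * t\<rfloor> \<le> 10 ^ k * M"
    by (simp add: trunc10_def divide_le_eq mult.commute)
  also have "\<dots> \<longleftrightarrow> \<lfloor>10 ^ k * t\<rfloor> < \<lfloor>10 ^ k * M\<rfloor> + 1" by (simp add: le_floor_iff[symmetric])
  also have "\<dots> \<longleftrightarrow> 10 ^ k * t < of_int \<lfloor>10 ^ k * M\<rfloor> + 1" by (subst floor_less_iff) simp
  also have "\<dots> \<longleftrightarrow> t < threshold M k"
    by (simp add: threshold_def less_divide_eq mult.commute)
  finally show ?thesis .
qed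

lemma threshold_pos: "0 \<le> M \<Longrightarrow> 0 < threshold M k"
  unfolding threshold_def by (intro divide_pos_pos add_nonneg_pos) auto

text \<open>Every multiple of \<open>1 / 10 ^ k\<close> is also a multiple of
  \<open>1 / 10 ^ Suc k\<close>, so the least one above \<open>M\<close> can only decrease on the
  finer grid.\<close>

lemma threshold_Suc_le:
  "threshold M (Suc k) \<le> threshold M k"
proof -
  define x where "x = 10 ^ k * M"
  have Suc: "10 ^ Suc k * M = 10 * x" by (simp add: x_def)
  have "x < of_int \<lfloor>x\<rfloor> + 1" by linarith
  then have "10 * x < 10 * (of_int \<lfloor>x\<rfloor> + 1)" by (rule mult_strict_left_mono) simp
  also have "\<dots> = of_int (10 * (\<lfloor>x\<rfloor> + 1))" by simp
  finally have "10 * x < of_int (10 * (\<lfloor>x\<rfloor> + 1))" .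
  then have "\<lfloor>10 * x\<rfloor> < 10 * (\<lfloor>x\<rfloor> + 1)" by (simp only: floor_less_iff)
  then have "real_of_int (\<lfloor>10 * x\<rfloor> + 1) \<le> of_int (10 * (\<lfloor>x\<rfloor> + 1))"
    unfolding of_int_le_iff by (rule zless_imp_add1_zle)
  then show ?thesis unfolding threshold_def Suc x_def[symmetric] by (simp add: divide_simps)
qed

text \<open>Scaled by \<open>10 ^ k\<close>, the intervals of \<open>S9 (Suc k)\<close> are those
  from \<open>n + 9/10\<close> to \<open>n + 1\<close>. Outside them the next digit is at most 8,
  and the finer grid has a point above \<open>M\<close> before the coarse one.\<close>

lemma threshold_Suc_less:
  assumes "0 \<le> M" "M \<notin> S9 (Suc k)"
  shows "threshold M (Suc k) < threshold M k"
proof -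
  define n where "n = nat \<lfloor>10 ^ k * M\<rfloor>"
  define f where "f = \<lfloor>10 ^ Suc k * M\<rfloor>"
  have n: "of_int \<lfloor>10 ^ k * M\<rfloor> = real n" using assms(1) by (simp add: n_def)
  have hi: "10 ^ k * M < real n + 1" using n by linarith
  have "\<not> (real n + 9/10 \<le> 10 ^ k * M)"
  proof
    assume lo: "real n + 9/10 \<le> 10 ^ k * M"
    have "M \<in> {(real n + 9/10) * 10 powi (1 - int (Suc k)) ..< (real n + 1) * 10 powi (1 - int (Suc k))}"
      using lo hi by (simp add: power_int_minus field_simps)
    then show False using assms(2) unfolding S9_def by blast
  qed
  then have "10 ^ Suc k * M < 10 * real n + 9" by simp
  then have "f < 10 * int n + 9" unfolding f_def by linarith
  then have "real_of_int (f + 1) < real_of_int (10 * (int n + 1))" by (intro iffD2[OF of_int_less_iff]) simp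
  then have "real_of_int f + 1 < 10 * (real n + 1)" by simp
  then show ?thesis
    unfolding threshold_def n f_def[symmetric] by (simp add: divide_simps)
qed

text \<open>Apart from the equation \<open>a x\<^sub>0 + b x\<^sub>1 = c\<close> in the first row, these systems are zero.\<close>

definition two_coeff_input :: "nat \<Rightarrow> nat \<Rightarrow> real \<Rightarrow> real \<Rightarrow> real \<Rightarrow> input" where
  "two_coeff_input m N c a b =
     (Matrix.vec m (\<lambda>i. if i = 0 then c else 0),
      Matrix.mat m N (\<lambda>(i, j). if i = 0 \<and> j = 0 then a else if i = 0 \<and> j = 1 then b else 0))"

text \<open>The entries of the matrix follow the \<open>m\<close> entries of \<open>y\<close> row by
  row; as the first row has at least two entries, \<open>a\<close> and \<open>b\<close> are numbered
  \<open>m\<close> and \<open>m + 1\<close>.\<close>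

lemma coord_two_coeff_input:
  assumes "1 \<le> m" "2 \<le> N" "j < num_vars m N"
  shows "coord m N (two_coeff_input m N c a b) j =
    (if j = 0 then c else if j = m then a else if j = m + 1 then b else 0)"
proof (cases "j < m")
  case True
  then show ?thesis using assms by (simp add: coord_def two_coeff_input_def)
next
  case False
  define i where "i = j - m"
  have j: "j = m + i" using False by (simp add: i_def)
  have "i < m * N" using assms(3) by (simp add: j num_vars_def)
  then have "i div N < m" "i mod N < N" using assms(2) by (auto simp: less_mult_imp_div_less)
  moreover have "i div N = 0 \<and> i mod N = 0 \<longleftrightarrow> i = 0" using assms(2) by (auto simp: div_eq_0_iff)
  moreover have "i div N = 0 \<and> i mod N = Suc 0 \<longleftrightarrow> i = Suc 0" using assms(2) by (auto simp: div_eq_0_iff)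
  ultimately show ?thesis using assms(1) j by (auto simp: coord_def two_coeff_input_def)
qed

section \<open>Reduction to two unknowns\<close>

lemma two_coeff_input_solution:
  assumes "1 \<le> m" "2 \<le> N" "x \<in> carrier_vec N"
  shows "snd (two_coeff_input m N c a b) *\<^sub>v x = fst (two_coeff_input m N c a b) \<longleftrightarrow>
    a * vec_index x 0 + b * vec_index x 1 = c"
proof -
  have row0: "(\<Sum>j = 0..<N. (if j = 0 then a else if j = 1 then b else 0) * vec_index x j) =
      a * vec_index x 0 + b * vec_index x 1"
  proof -
    have "(\<Sum>j = 0..<N. (if j = 0 then a else if j = 1 then b else 0) * vec_index x j) =
        (\<Sum>j \<in> {0, 1}. (if j = 0 then a else if j = 1 then b else 0) * vec_index x j)"
      using assms(2) by (intro sum.mono_neutral_right) auto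
    then show ?thesis by simp
  qed
  have "vec_index (snd (two_coeff_input m N c a b) *\<^sub>v x) i =
      (if i = 0 then a * vec_index x 0 + b * vec_index x 1 else 0)" if "i < m" for i
  proof -
    have "vec_index (snd (two_coeff_input m N c a b) *\<^sub>v x) i =
        (\<Sum>j = 0..<N. (if i = 0 \<and> j = 0 then a else if i = 0 \<and> j = 1 then b else 0) * vec_index x j)"
      using that assms(3) by (simp add: two_coeff_input_def scalar_prod_def)
    then show ?thesis using row0 by (cases "i = 0") (simp_all cong: if_cong)
  qed
  then show ?thesis using assms(1) by (auto simp: two_coeff_input_def vec_eq_iff)
qed

text \<open>The unknowns beyond the first two occur in no equation with nonzero coefficient; setting
  them to 0 keeps a solution and cannot raise the total.\<close>

lemma Xi_two_coeff_input:
  assumes m: "1 \<le> m" and N: "2 \<le> N"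
  shows "Xi M k (two_coeff_input m N c a b) =
    (if \<exists>p\<ge>0. \<exists>q\<ge>0. a * p + b * q = c \<and> p + q < threshold M k then 1 else 0)"
proof -
  define y A where "y = fst (two_coeff_input m N c a b)" and "A = snd (two_coeff_input m N c a b)"
  have inp: "two_coeff_input m N c a b = (y, A)" by (simp add: y_def A_def)
  have dimA: "dim_col A = N" by (simp add: A_def two_coeff_input_def)
  have total: "scalar_prod x (Matrix.vec N (\<lambda>_. 1)) = (\<Sum>i = 0..<N. vec_index x i)"
    for x :: "real Matrix.vec"
    by (simp add: scalar_prod_def)
  have sol: "A *\<^sub>v x = y \<longleftrightarrow> a * vec_index x 0 + b * vec_index x 1 = c" if "x \<in> carrier_vec N" for x
    unfolding A_def y_def using two_coeff_input_solution[OF m N that] .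
  have "(\<exists>x \<in> carrier_vec N. trunc10 k (scalar_prod x (Matrix.vec N (\<lambda>_. 1))) \<le> M \<and>
      A *\<^sub>v x = y \<and> (\<forall>i<N. 0 \<le> vec_index x i)) \<longleftrightarrow>
    (\<exists>p\<ge>0. \<exists>q\<ge>0. a * p + b * q = c \<and> p + q < threshold M k)" (is "?L \<longleftrightarrow> ?R")
  proof
    assume ?L
    then obtain x where x: "x \<in> carrier_vec N" "(\<Sum>i = 0..<N. vec_index x i) < threshold M k"
      "a * vec_index x 0 + b * vec_index x 1 = c" "\<forall>i<N. 0 \<le> vec_index x i"
      using sol by (auto simp: trunc10_le_iff total)
    have "(\<Sum>i\<in>{0, 1}. vec_index x i) \<le> (\<Sum>i = 0..<N. vec_index x i)"
      using N x(4) by (intro sum_mono2) auto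
    then have "vec_index x 0 + vec_index x 1 < threshold M k" using x(2) by simp
    then show ?R using x N by (intro exI[of _ "vec_index x 0"] exI[of _ "vec_index x 1"] conjI) auto
  next
    assume ?R
    then obtain p q where pq: "p \<ge> 0" "q \<ge> 0" "a * p + b * q = c" "p + q < threshold M k" by blast
    define x where "x = Matrix.vec N (\<lambda>i. if i = 0 then p else if i = 1 then q else 0)"
    have "(\<Sum>i = 0..<N. vec_index x i) = (\<Sum>i\<in>{0, 1}. vec_index x i)"
      using N by (intro sum.mono_neutral_right) (auto simp: x_def)
    also have "\<dots> = p + q" using N by (simp add: x_def)
    finally have "(\<Sum>i = 0..<N. vec_index x i) = p + q" .
    then show ?L using pq N sol[of x]
      by (intro bexI[of _ x]) (auto simp: trunc10_le_iff total x_def)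
  qed
  then show ?thesis by (simp add: Xi_def inp dimA)
qed

text \<open>
  The least total \<open>x\<^sub>0 + x\<^sub>1\<close> is \<open>0\<close> on the first part, \<open>u\<close> on the second and \<open>u'\<close> on the third. The
  inputs of the second part tend to \<open>(0, 1, 0)\<close> as \<open>d \<rightarrow> 0\<close>, where the minimum jumps to \<open>0\<close>;
  those of the third part come arbitrarily close to the first part without a limit in the class.
\<close>

definition jump_class :: "real \<Rightarrow> real \<Rightarrow> family" where
  "jump_class u u' m N =
     {two_coeff_input m N 0 a 0 | a. 0 < a} \<union>
     {two_coeff_input m N (- u * d) 1 (- d) | d. 0 < d} \<union>
     {two_coeff_input m N (- u' * d) (- d) 0 | d. 0 < d}"

lemma input_class_jump_class: "D \<subseteq> all_dims \<Longrightarrow> input_class D (jump_class u u')"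
  by (auto simp: input_class_def jump_class_def two_coeff_input_def intro: exI[of _ "1::real"])

lemma Xi_zero_rhs:
  assumes "1 \<le> m" "2 \<le> N" "0 \<le> M"
  shows "Xi M k (two_coeff_input m N 0 a b) = 1"
  using threshold_pos[OF assms(3), of k] unfolding Xi_two_coeff_input[OF assms(1,2)]
  by (auto intro!: exI[of _ "0::real"])

text \<open>The equation says \<open>p = d * (q - u)\<close>, so \<open>p >= 0\<close> forces
  \<open>q >= u\<close>. The minimum \<open>u\<close> is attained at \<open>p = 0\<close>,
  \<open>q = u\<close>, whatever \<open>d\<close> is.\<close>

lemma Xi_jump:
  assumes "1 \<le> m" "2 \<le> N" "0 \<le> u" "0 < d"
  shows "Xi M k (two_coeff_input m N (- u * d) 1 (- d)) = (if u < threshold M k then 1 else 0)"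
proof -
  have "(\<exists>p\<ge>0. \<exists>q\<ge>0. 1 * p + - d * q = - u * d \<and> p + q < threshold M k) \<longleftrightarrow> u < threshold M k"
    (is "?L \<longleftrightarrow> ?R")
  proof
    assume ?L
    then obtain p q where pq: "p \<ge> 0" "q \<ge> 0" "1 * p + - d * q = - u * d" "p + q < threshold M k"
      by blast
    have "d * u \<le> d * q" using pq by (simp add: mult.commute)
    then have "u \<le> q" using assms(4) by simp
    then show ?R using pq by linarith
  next
    assume ?R
    then show ?L using assms(3) by - (rule exI[of _ 0], rule conjI, simp, rule exI[of _ u], simp)
  qed
  then show ?thesis unfolding Xi_two_coeff_input[OF assms(1,2)] by simp
qed

text \<open>Dividing by \<open>- d\<close> leaves \<open>p = u\<close> with \<open>q\<close> free,
  so scaling the equation towards zero does not move the minimum.\<close>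

lemma Xi_scaled:
  assumes "1 \<le> m" "2 \<le> N" "0 \<le> u" "0 < d"
  shows "Xi M k (two_coeff_input m N (- u * d) (- d) 0) = (if u < threshold M k then 1 else 0)"
proof -
  have "- d * p + 0 * q = - u * d \<longleftrightarrow> p = u" for p q
    using assms(4) by (auto simp: mult.commute)
  then have "(\<exists>p\<ge>0. \<exists>q\<ge>0. - d * p + 0 * q = - u * d \<and> p + q < threshold M k) \<longleftrightarrow>
      (\<exists>q\<ge>0. u + q < threshold M k)"
    using assms(3) by (simp only: simp_thms ex_simps) blast
  also have "\<dots> \<longleftrightarrow> u < threshold M k" by (auto intro: exI[of _ 0])
  finally have "(\<exists>p\<ge>0. \<exists>q\<ge>0. - d * p + 0 * q = - u * d \<and> p + q < threshold M k) \<longleftrightarrow> u < threshold M k" .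
  then show ?thesis unfolding Xi_two_coeff_input[OF assms(1,2)] by simp
qed

text \<open>The coordinates perturbed below are \<open>d\<close> and \<open>u * d\<close>; the
  factor \<open>1 + u\<close> in the denominator controls both at once.\<close>

lemma small_scale:
  fixes u :: real
  assumes "0 \<le> u"
  obtains d where "0 < d" "d \<le> 1 / 2 ^ T" "u * d \<le> 1 / 2 ^ T"
proof
  show "0 < 1 / (2 ^ T * (1 + u))" "1 / (2 ^ T * (1 + u)) \<le> 1 / 2 ^ T" "u * (1 / (2 ^ T * (1 + u))) \<le> 1 / 2 ^ T"
    using assms by (auto simp: divide_simps)
qed

text \<open>As \<open>d\<close> tends to 0 the equation becomes \<open>x_0 = 0\<close>, which the
  zero vector solves, yet for each positive \<open>d\<close> the total stays at least
  \<open>u\<close>.\<close>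

lemma jump_class_discontinuity:
  assumes "1 \<le> m" "2 \<le> N" "0 \<le> M" and u: "0 \<le> u" "threshold M k \<le> u"
  obtains \<iota>0 r0 where "\<iota>0 \<in> jump_class u u' m N" "represents m N \<iota>0 r0" "Xi M k \<iota>0 = 1"
    "\<And>T. \<exists>\<iota>\<in>jump_class u u' m N. \<exists>r. represents m N \<iota> r \<and> Xi M k \<iota> = 0 \<and> (\<forall>j. \<forall>n\<le>T. r j n = r0 j n)"
proof
  \<comment> \<open>These are the coordinates of the limit point; being integers, they serve as its
    exact answers and as the first \<open>T\<close> answers for its neighbours.\<close>
  let ?z = "\<lambda>j. if j = m then 1 else 0 :: int"
  let ?\<iota>0 = "two_coeff_input m N 0 1 0"
  let ?r0 = "\<lambda>j n. if (j, n) \<in> evals m N then of_int (?z j) else 0 :: real"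
  show "?\<iota>0 \<in> jump_class u u' m N"
    unfolding jump_class_def by (auto intro!: exI[of _ "1::real"])
  show "represents m N ?\<iota>0 ?r0"
    using assms(1,2) by (intro represents_integral) (auto simp: coord_two_coeff_input)
  show "Xi M k ?\<iota>0 = 1" using assms by (simp add: Xi_zero_rhs)
  show "\<exists>\<iota>\<in>jump_class u u' m N. \<exists>r. represents m N \<iota> r \<and> Xi M k \<iota> = 0 \<and> (\<forall>j. \<forall>n\<le>T. r j n = ?r0 j n)" for T
  proof -
    obtain d where d: "0 < d" "d \<le> 1 / 2 ^ T" "u * d \<le> 1 / 2 ^ T"
      using small_scale[OF u(1)] by blast
    let ?\<iota> = "two_coeff_input m N (- u * d) 1 (- d)"
    have "?\<iota> \<in> jump_class u u' m N" unfolding jump_class_def using d(1) by blast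
    moreover have "represents m N ?\<iota> (near_rep m N ?z T ?\<iota>)"
      using assms d by (intro represents_near_rep) (auto simp: coord_two_coeff_input)
    moreover have "Xi M k ?\<iota> = 0" using Xi_jump[OF assms(1,2) u(1) d(1)] u(2) by simp
    moreover have "\<forall>j. \<forall>n\<le>T. near_rep m N ?z T ?\<iota> j n = ?r0 j n" by (simp add: near_rep_agree)
    ultimately show ?thesis by blast
  qed
qed

text \<open>Both inputs are close to the zero system, which is outside the class, and both may
  answer 0 up to precision \<open>T\<close>. They differ in the sign of the leading
  coefficient.\<close>

lemma jump_class_close_pairs:
  assumes "1 \<le> m" "2 \<le> N" "0 \<le> M" and u': "0 \<le> u'" "threshold M k \<le> u'"
  shows "\<exists>\<iota>\<in>jump_class u u' m N. \<exists>\<iota>'\<in>jump_class u u' m N. \<exists>r r'. represents m N \<iota> r \<and>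
    represents m N \<iota>' r' \<and> Xi M k \<iota> \<noteq> Xi M k \<iota>' \<and> (\<forall>j. \<forall>n\<le>T. r' j n = r j n)"
proof -
  obtain d where d: "0 < d" "d \<le> 1 / 2 ^ T" "u' * d \<le> 1 / 2 ^ T"
    using small_scale[OF u'(1)] by blast
  let ?\<iota> = "two_coeff_input m N 0 d 0" and ?\<iota>' = "two_coeff_input m N (- u' * d) (- d) 0"
  have "?\<iota> \<in> jump_class u u' m N" "?\<iota>' \<in> jump_class u u' m N"
    unfolding jump_class_def using d(1) by blast+
  moreover have "represents m N ?\<iota> (near_rep m N (\<lambda>_. 0) T ?\<iota>)" "represents m N ?\<iota>' (near_rep m N (\<lambda>_. 0) T ?\<iota>')"
    using assms d by (intro represents_near_rep; auto simp: coord_two_coeff_input)+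
  moreover have "Xi M k ?\<iota> \<noteq> Xi M k ?\<iota>'"
    using Xi_scaled[OF assms(1,2) u'(1) d(1)] u'(2) Xi_zero_rhs[OF assms(1-3)] by simp
  moreover have "\<forall>j. \<forall>n\<le>T. near_rep m N (\<lambda>_. 0) T ?\<iota>' j n = near_rep m N (\<lambda>_. 0) T ?\<iota> j n"
    by (simp add: near_rep_agree)
  ultimately show ?thesis by blast
qed

text \<open>The leading coefficient is positive on the first two parts, where the minimum 0 or
  \<open>u\<close> is below the threshold, and negative on the third, where the minimum
  \<open>u'\<close> is not.\<close>

lemma jump_class_sign:
  assumes "1 \<le> m" "2 \<le> N" "0 \<le> M" "0 \<le> u" "u < threshold M k" "threshold M k \<le> u'"
    and "\<iota> \<in> jump_class u u' m N"
  shows "coord m N \<iota> m \<noteq> 0" "Xi M k \<iota> = (if 0 < coord m N \<iota> m then 1 else 0)"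
proof -
  have "m < num_vars m N" using assms(1,2) by (simp add: num_vars_def)
  note c = coord_two_coeff_input[OF assms(1,2) this]
  show "coord m N \<iota> m \<noteq> 0" "Xi M k \<iota> = (if 0 < coord m N \<iota> m then 1 else 0)"
    using assms Xi_zero_rhs[OF assms(1-3)] Xi_jump[OF assms(1,2), where M = M]
      Xi_scaled[OF assms(1,2), where M = M]
    unfolding jump_class_def by (auto simp: c)
qed


section \<open>Machines deciding the sign of the leading matrix entry\<close>

text \<open>Cell 0 holds \<open>m\<close>, the number of the leading entry; cell 2 is the precision,
  cell 4 the answer and cell 5 its negative. Cells 3 and 6 hold the outputs 1 and 0, cell 6 being
  never written. Passing both branch tests means that the answer is zero, and the loop
  restarts.\<close>

definition sign_bss :: bss where
  "sign_bss = [Const 2 0, Const 3 1, Add 2 2 3, Ask 4 0 2, Sub 5 6 4, Branch 4 7, Output 6,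
     Branch 5 2, Output 3]"

text \<open>Loop invariant at instruction 2 after \<open>n\<close> rounds.\<close>

definition bss_loop :: "nat \<Rightarrow> nat \<Rightarrow> bss_config \<Rightarrow> bool" where
  "bss_loop m n c \<longleftrightarrow> fst c = 2 \<and> snd c 0 = real m \<and> snd c 2 = real n \<and> snd c 3 = 1 \<and> snd c 6 = 0"

lemma bss_loop_init: "bss_loop m 0 (bss_run sign_bss r m N 2)"
  by (simp add: bss_loop_def bss_run_def numeral_2_eq_2 bss_init_def bss_step_def sign_bss_def)

lemma funpow_4_5: "(f ^^ 5) x = f (f (f (f (f x))))" "(f ^^ 4) x = f (f (f (f x)))"
  by (simp_all add: numeral_eq_Suc)

lemma bss_loop_step:
  assumes "bss_loop m n c" "r m (Suc n) = 0"
  shows "bss_loop m (Suc n) ((bss_step sign_bss r ^^ 5) c)"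
proof (cases c)
  case (Pair pc s)
  have "s 2 + s 3 = real (Suc n)" "s 0 = real m" "s 6 = 0" "s 3 = 1" "pc = 2"
    using assms(1) Pair by (auto simp: bss_loop_def)
  then show ?thesis using assms(2) Pair
    by (simp add: funpow_4_5 bss_loop_def bss_step_def sign_bss_def del: of_nat_Suc)
qed

text \<open>A negative answer fails the first branch test and reaches its output after four steps; a
  positive one fails only the second, after five.\<close>

lemma bss_loop_exit:
  assumes "bss_loop m n c" "r m (Suc n) \<noteq> 0"
  shows "\<exists>t pc s. (bss_step sign_bss r ^^ t) c = (pc, s) \<and> pc < length sign_bss \<and>
    (\<exists>a. sign_bss ! pc = Output a \<and> s a = (if 0 < r m (Suc n) then 1 else 0))"
proof (cases c)
  case (Pair pc s)
  have *: "s 2 + s 3 = real (Suc n)" "s 0 = real m" "s 6 = 0" "s 3 = 1" "pc = 2"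
    using assms(1) Pair by (auto simp: bss_loop_def)
  show ?thesis
  proof (cases "0 < r m (Suc n)")
    case True
    with * Pair show ?thesis
      by - (rule exI[of _ 5], simp add: funpow_4_5 bss_step_def sign_bss_def del: of_nat_Suc)
  next
    case False
    with assms(2) have "r m (Suc n) < 0" by simp
    with * Pair show ?thesis
      by - (rule exI[of _ 4], simp add: funpow_4_5 bss_step_def sign_bss_def del: of_nat_Suc)
  qed
qed

lemma sign_bss_correct:
  assumes "r m (Suc n) \<noteq> 0" and zero: "\<And>i. i < n \<Longrightarrow> r m (Suc i) = 0"
  shows "\<exists>t. bss_halts_with sign_bss r m N t (if 0 < r m (Suc n) then 1 else 0)"
proof -
  have "\<exists>t. bss_loop m i (bss_run sign_bss r m N t)" if "i \<le> n" for i
    using that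
  proof (induction i)
    case 0
    then show ?case using bss_loop_init by blast
  next
    case (Suc i)
    then obtain t where "bss_loop m i (bss_run sign_bss r m N t)" by auto
    then have "bss_loop m (Suc i) (bss_run sign_bss r m N (5 + t))"
      using bss_loop_step[of m i _ r] zero[of i] Suc.prems by (simp add: bss_run_def funpow_add)
    then show ?case by blast
  qed
  then obtain t where "bss_loop m n (bss_run sign_bss r m N t)" by blast
  from bss_loop_exit[of m n _ r, OF this assms(1)] obtain t' pc s a
    where "bss_run sign_bss r m N (t' + t) = (pc, s)" "pc < length sign_bss"
      "sign_bss ! pc = Output a" "s a = (if 0 < r m (Suc n) then 1 else 0)"
    by (auto simp: bss_run_def funpow_add)
  then have "bss_halts_with sign_bss r m N (t' + t) (if 0 < r m (Suc n) then 1 else 0)"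
    by (auto simp: bss_halts_with_def)
  then show ?thesis by blast
qed

text \<open>
  State 0 copies \<open>1\<^sup>m #\<close> to the query tape; state 1 inspects the sign of the previous answer, if
  any, and appends one more digit to the query as long as the answer is zero.
\<close>

definition sign_delta :: "nat \<Rightarrow> (tape \<Rightarrow> sym) \<Rightarrow> nat \<times> (tape \<Rightarrow> sym \<times> dir)" where
  "sign_delta q a =
     (if q = 0 then
        (if a InputT = One then (0, (\<lambda>d. (a d, Stay))(InputT := (One, MoveR), QueryT := (One, MoveR)))
         else (1, (\<lambda>d. (a d, Stay))(QueryT := (Sep, MoveR))))
      else if a AnswerT = One then (3, \<lambda>d. (a d, Stay))
      else if a AnswerT = Minus then (4, \<lambda>d. (a d, Stay))
      else (2, (\<lambda>d. (a d, Stay))(QueryT := (One, MoveR))))"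

definition sign_tm :: tm where
  "sign_tm = \<lparr> tm_states = 5, tm_start = 0, tm_ask = 2, tm_resume = 1, tm_accept = 3, tm_reject = 4,
     tm_delta = sign_delta \<rparr>"

lemma tm_wf_sign_tm: "tm_wf sign_tm"
  by (auto simp: tm_wf_def sign_tm_def sign_delta_def)

section \<open>Words on tapes\<close>

lemma tape_of_append: "(tape_of w)(int (length w) := c) = tape_of (w @ [c])"
  by (auto simp: tape_of_def fun_eq_iff nth_append)

text \<open>The first blank cell marks the end of the word. This makes the query read off a tape
  unique.\<close>

lemma tape_of_inj:
  assumes "tape_of v = tape_of w" "Blank \<notin> set v" "Blank \<notin> set w"
  shows "v = w"
proof -
  have blank: "i < length u \<longleftrightarrow> tape_of u (int i) \<noteq> Blank" if "Blank \<notin> set u" for u i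
    using that by (auto simp: tape_of_def in_set_conv_nth)
  have "i < length v \<longleftrightarrow> i < length w" for i
    using blank[OF assms(2)] blank[OF assms(3)] assms(1) by simp
  then have len: "length v = length w" by (meson linorder_neq_iff)
  have "v ! i = w ! i" if "i < length v" for i
    using fun_cong[OF assms(1), of "int i"] that len by (simp add: tape_of_def)
  with len show ?thesis by (simp add: list_eq_iff_nth_eq)
qed

lemma pair_word_inj: "pair_word a b = pair_word a' b' \<longleftrightarrow> a = a' \<and> b = b'"
proof
  assume eq: "pair_word a b = pair_word a' b'"
  have tw: "takeWhile (\<lambda>s. s = One) (pair_word a b) = replicate a One" for a b
    by (induction a) (simp_all add: pair_word_def)
  have "a = a'" using arg_cong[OF eq, of "\<lambda>w. length (takeWhile (\<lambda>s. s = One) w)"] by (simp add: tw)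
  with arg_cong[OF eq, of length] show "a = a' \<and> b = b'" by (simp add: pair_word_def)
qed auto

lemma tape_of_pair_word_inj: "tape_of (pair_word a b) = tape_of (pair_word a' b') \<longleftrightarrow> a = a' \<and> b = b'"
proof -
  have "Blank \<notin> set (pair_word a b)" for a b by (auto simp: pair_word_def)
  then show ?thesis using tape_of_inj pair_word_inj by metis
qed

lemma bin_word_Cons: "1 \<le> k \<Longrightarrow> \<exists>w. bin_word k = One # w"
proof (induction k rule: less_induct)
  case (less k)
  show ?case
  proof (cases "k < 2")
    case True
    with less.prems have "k = 1" by simp
    then show ?thesis by (simp add: bin_word.simps)
  next
    case False
    then have "k div 2 < k" "1 \<le> k div 2" by linarith+
    then obtain w where "bin_word (k div 2) = One # w" using less.IH by blast
    then show ?thesis using False by (subst bin_word.simps) auto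
  qed
qed

text \<open>A positive number has no leading zero in binary, so the first symbol of an answer
  already reveals its sign and the answer head never has to move.\<close>

lemma tape_of_int_word_0:
  "tape_of (int_word k) 0 = (if 0 < k then One else if k < 0 then Minus else Zero)"
proof -
  consider "0 < k" | "k < 0" | "k = 0" by linarith
  then show ?thesis
  proof cases
    case 1
    then have "1 \<le> nat k" by simp
    then obtain w where "bin_word (nat k) = One # w" using bin_word_Cons by blast
    with 1 show ?thesis by (simp add: tape_of_def int_word_def)
  qed (simp_all add: tape_of_def int_word_def bin_word.simps)
qed

section \<open>Runs of the Turing machine\<close>

text \<open>The query head stands just past the word, so that writing one \<open>One\<close> raises
  the precision by 1. The scanned answer symbol is tracked separately, as it decides whether the
  loop continues.\<close>

definition tm_loop :: "nat \<Rightarrow> nat \<Rightarrow> tm_config \<Rightarrow> bool" where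
  "tm_loop m n c \<longleftrightarrow> state c = 1 \<and> cells c QueryT = tape_of (pair_word m n) \<and>
     head c QueryT = int (m + 1 + n)"

lemma tm_copy_phase:
  assumes "i \<le> m"
  shows "\<exists>c. tm_run sign_tm r m N i = c \<and> state c = 0 \<and> cells c InputT = tape_of (pair_word m N) \<and>
    head c InputT = int i \<and> cells c QueryT = tape_of (replicate i One) \<and> head c QueryT = int i \<and>
    cells c AnswerT = tape_of [] \<and> head c AnswerT = 0"
  using assms
proof (induction i)
  case 0
  show ?case by (simp add: tm_run_def tm_init_def sign_tm_def)
next
  case (Suc i)
  then obtain c where c: "tm_run sign_tm r m N i = c" "state c = 0"
    "cells c InputT = tape_of (pair_word m N)" "head c InputT = int i"
    "cells c QueryT = tape_of (replicate i One)" "head c QueryT = int i"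
    "cells c AnswerT = tape_of []" "head c AnswerT = 0" by auto
  have One: "tape_of (pair_word m N) (int i) = One"
    using Suc.prems by (simp add: tape_of_def pair_word_def nth_append)
  then have triv: "(tape_of (pair_word m N))(int i := One) = tape_of (pair_word m N)"
    by (metis fun_upd_triv)
  have "tm_run sign_tm r m N (Suc i) = tm_work_step sign_tm c"
    using c(1,2) by (simp add: tm_run_def tm_step_def tm_halted_def sign_tm_def)
  then show ?case
    using c One tape_of_append[of "replicate i One" One]
    by (simp add: tm_work_step_def sign_tm_def sign_delta_def triv replicate_append_same)
qed

text \<open>Before the first query the answer tape is blank, and state 1 treats a blank like a zero
  answer; the loop therefore starts uniformly at \<open>n = 0\<close>.\<close>

lemma tm_loop_init:
  "\<exists>c. tm_run sign_tm r m N (Suc m) = c \<and> tm_loop m 0 c \<and> cells c AnswerT (head c AnswerT) = Blank"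
proof -
  obtain c where c: "tm_run sign_tm r m N m = c" "state c = 0"
    "cells c InputT = tape_of (pair_word m N)" "head c InputT = int m"
    "cells c QueryT = tape_of (replicate m One)" "head c QueryT = int m"
    "cells c AnswerT = tape_of []" "head c AnswerT = 0" using tm_copy_phase[of m m r N] by auto
  have Sep: "tape_of (pair_word m N) (int m) = Sep"
    by (simp add: tape_of_def pair_word_def nth_append)
  have "tm_run sign_tm r m N (Suc m) = tm_work_step sign_tm c"
    using c(1,2) by (simp add: tm_run_def tm_step_def tm_halted_def sign_tm_def)
  then show ?thesis
    using c Sep tape_of_append[of "replicate m One" Sep]
    by (simp add: tm_work_step_def sign_tm_def sign_delta_def tm_loop_def pair_word_def)
       (simp add: tape_of_def)
qed

lemma tm_run_add: "tm_run T r m N (s + t) = (tm_step T r ^^ s) (tm_run T r m N t)"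
  by (simp add: tm_run_def funpow_add)

text \<open>One round takes two steps: lengthening the query word, then asking the oracle.\<close>

lemma tm_loop_step:
  fixes r :: oracle_rep
  assumes "tm_loop m n c" "cells c AnswerT (head c AnswerT) \<notin> {One, Minus}"
  defines "c' \<equiv> (tm_step sign_tm r ^^ 2) c" and "k \<equiv> \<lfloor>r m (Suc n) * 2 ^ Suc n\<rfloor>"
  shows "tm_loop m (Suc n) c'"
    and "cells c' AnswerT (head c' AnswerT) = (if 0 < k then One else if k < 0 then Minus else Zero)"
proof -
  define c1 where "c1 = tm_work_step sign_tm c"
  have c: "state c = 1" "cells c QueryT = tape_of (pair_word m n)" "head c QueryT = int (m + 1 + n)"
    using assms(1) by (auto simp: tm_loop_def)
  have s1: "tm_step sign_tm r c = c1"
    using c(1) by (simp add: c1_def tm_step_def tm_halted_def sign_tm_def)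
  have append: "(tape_of (pair_word m n))(int (m + 1 + n) := One) = tape_of (pair_word m (Suc n))"
    using tape_of_append[of "pair_word m n" One]
    by (simp add: pair_word_def replicate_append_same add_ac)
  have c1: "state c1 = 2" "cells c1 QueryT = tape_of (pair_word m (Suc n))"
      "head c1 QueryT = int (m + 1 + Suc n)"
    using c append assms(2) by (simp_all add: c1_def tm_work_step_def sign_tm_def sign_delta_def)
  have "tm_queries sign_tm c1 = {(m, Suc n)}"
    using c1 by (auto simp: tm_queries_def tape_of_pair_word_inj sign_tm_def)
  then have s2: "tm_step sign_tm r c1 = \<lparr> state = 1,
      cells = (cells c1)(AnswerT := tape_of (int_word \<lfloor>r m (Suc n) * 2 ^ Suc n\<rfloor>)),
      head = (head c1)(AnswerT := 0) \<rparr>"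
    using c1(1) by (simp add: tm_step_def tm_halted_def sign_tm_def)
  have "c' = tm_step sign_tm r c1" by (simp add: c'_def numeral_2_eq_2 s1)
  then show "tm_loop m (Suc n) c'"
    and "cells c' AnswerT (head c' AnswerT) = (if 0 < k then One else if k < 0 then Minus else Zero)"
    using c1 unfolding s2 k_def[symmetric] by (simp_all add: tm_loop_def tape_of_int_word_0)
qed

lemma sign_tm_correct:
  assumes nz: "r m (Suc n) \<noteq> 0" "r m (Suc n) \<in> dyadics (Suc n)" and zero: "\<And>i. i < n \<Longrightarrow> r m (Suc i) = 0"
  shows "\<exists>t. tm_halts_with sign_tm r m N t (if 0 < r m (Suc n) then 1 else 0)"
proof -
  have "\<exists>t c. tm_run sign_tm r m N t = c \<and> tm_loop m i c \<and> cells c AnswerT (head c AnswerT) \<notin> {One, Minus}"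
    if "i \<le> n" for i
    using that
  proof (induction i)
    case 0
    then show ?case using tm_loop_init[of r m N] by fastforce
  next
    case (Suc i)
    then obtain t c where c: "tm_run sign_tm r m N t = c" "tm_loop m i c"
      "cells c AnswerT (head c AnswerT) \<notin> {One, Minus}" by auto
    have "\<lfloor>r m (Suc i) * 2 ^ Suc i\<rfloor> = 0" using zero[of i] Suc.prems by simp
    note step = tm_loop_step[OF c(2,3), of r, unfolded this]
    have "tm_run sign_tm r m N (2 + t) = (tm_step sign_tm r ^^ 2) c" unfolding tm_run_add c(1) ..
    with step show ?case by (intro exI conjI) (assumption, assumption, simp)
  qed
  then obtain t c where c: "tm_run sign_tm r m N t = c" "tm_loop m n c"
    "cells c AnswerT (head c AnswerT) \<notin> {One, Minus}" by blast
  \<comment> \<open>For a dyadic value the floor in the oracle answer is exact; otherwise a small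
    positive value could be reported as 0.\<close>
  obtain k where k: "r m (Suc n) = of_int k / 2 ^ Suc n" using nz(2) by (auto simp: dyadics_def)
  have k': "k \<noteq> 0" "0 < r m (Suc n) \<longleftrightarrow> 0 < k" using nz(1) k by (auto simp: zero_less_divide_iff)
  have floor: "\<lfloor>r m (Suc n) * 2 ^ Suc n\<rfloor> = k" by (simp add: k)
  define c' where "c' = (tm_step sign_tm r ^^ 2) c"
  have run: "tm_run sign_tm r m N (2 + t) = c'" unfolding c'_def tm_run_add c(1) ..
  note step = tm_loop_step[OF c(2,3), of r, unfolded floor, folded c'_def]
  have "cells c' AnswerT (head c' AnswerT) = (if 0 < r m (Suc n) then One else Minus)"
    unfolding step(2) k'(2) using k'(1) by simp
  note c' = step(1) this
  have "tm_run sign_tm r m N (1 + (2 + t)) = tm_step sign_tm r c'"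
    unfolding tm_run_add[of _ _ _ _ 1] run by simp
  also have "\<dots> = tm_work_step sign_tm c'"
    using c'(1) by (simp add: tm_loop_def tm_step_def tm_halted_def sign_tm_def)
  finally have "tm_halts_with sign_tm r m N (1 + (2 + t)) (if 0 < r m (Suc n) then 1 else 0)"
    using c' by (simp add: tm_halts_with_def tm_loop_def tm_work_step_def sign_tm_def sign_delta_def)
  then show ?thesis by blast
qed

text \<open>A nonzero coordinate has a nonzero answer at some precision, which gives termination.
  The first such answer ends both loops, and its sign is that of the coordinate.\<close>

lemma sign_machines_compute:
  assumes D: "D \<subseteq> all_dims"
    and sgn: "\<And>m N \<iota>. (m, N) \<in> D \<Longrightarrow> \<iota> \<in> \<Omega> m N \<Longrightarrow>
      coord m N \<iota> m \<noteq> 0 \<and> \<Xi> \<iota> = (if 0 < coord m N \<iota> m then 1 else 0)"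
  shows "tm_computes D \<Omega> \<Xi> sign_tm" "bss_computes D \<Omega> \<Xi> sign_bss"
proof -
  have "(\<exists>t. tm_halts_with sign_tm r m N t (\<Xi> \<iota>)) \<and> (\<exists>t. bss_halts_with sign_bss r m N t (\<Xi> \<iota>))"
    if mN: "(m, N) \<in> D" and \<iota>: "\<iota> \<in> \<Omega> m N" and r: "represents m N \<iota> r" for m N \<iota> r
  proof -
    have m: "m < num_vars m N" using D mN by (auto simp: all_dims_def num_vars_def)
    have nz: "coord m N \<iota> m \<noteq> 0" and \<Xi>: "\<Xi> \<iota> = (if 0 < coord m N \<iota> m then 1 else 0)"
      using sgn[OF mN \<iota>] by auto
    have "\<exists>n. r m (Suc n) \<noteq> 0"
      using represents_eventually_nonzero[OF r m nz] by (metis Suc_le_D One_nat_def)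
    then obtain n where n: "r m (Suc n) \<noteq> 0" "\<And>i. i < n \<Longrightarrow> r m (Suc i) = 0"
      using exists_least_iff[of "\<lambda>n. r m (Suc n) \<noteq> 0"] by auto
    have ev: "(m, Suc n) \<in> evals m N" using m by (simp add: evals_def)
    then have dy: "r m (Suc n) \<in> dyadics (Suc n)" using r unfolding represents_def by blast
    have "0 < r m (Suc n) \<longleftrightarrow> 0 < coord m N \<iota> m"
      using represents_sign[OF r ev] n(1) nz by linarith
    then show ?thesis
      using sign_tm_correct[of r m n, OF n(1) dy n(2)] sign_bss_correct[of r m n, OF n] \<Xi> by simp
  qed
  then show "tm_computes D \<Omega> \<Xi> sign_tm" "bss_computes D \<Omega> \<Xi> sign_bss"
    unfolding tm_computes_def bss_computes_def using tm_wf_sign_tm by auto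
qed

text \<open>The Turing machine starts in its accepting state, and the BSS machine outputs 1 after
  one assignment; neither asks the oracle.\<close>

lemma polynomially_solvable_const_one:
  assumes D: "D \<subseteq> all_dims" and one: "\<And>m N \<iota>. (m, N) \<in> D \<Longrightarrow> \<iota> \<in> \<Omega> m N \<Longrightarrow> \<Xi> \<iota> = 1"
  shows "polynomially_solvable D \<Omega> \<Xi>"
proof -
  define T where "T = \<lparr> tm_states = 3, tm_start = 0, tm_ask = 1, tm_resume = 1, tm_accept = 0,
    tm_reject = 2, tm_delta = (\<lambda>q a. (0, \<lambda>d. (a d, Stay))) \<rparr>"
  define P where "P = [Const 0 1, Output 0]"
  have wf: "tm_wf T" by (auto simp: tm_wf_def T_def)
  have tm: "tm_halts_with T r m N 0 1" and tm_asked: "tm_asked T r m N 0 = {}" for r m N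
    by (auto simp: tm_halts_with_def tm_run_def tm_init_def T_def tm_asked_def tm_queries_def)
  have bss: "bss_halts_with P r m N 1 1" and bss_asked: "bss_asked P r m N 1 = {}" for r m N
    by (auto simp: bss_halts_with_def bss_run_def bss_init_def P_def bss_step_def bss_asked_def
      bss_queries_def le_Suc_eq)
  have dig: "ereal_of_enat (digits {}) = 0" by (simp add: digits_def bot_enat_def)
  have UNIV_tape: "(UNIV :: tape set) = {InputT, QueryT, AnswerT, WorkT}"
    using tape.exhaust by auto
  have space: "tm_space T r m N 0 \<le> 4 + 4 * num_vars m N" if "1 \<le> m" for r m N
  proof -
    \<comment> \<open>At time 0 the heads are at cell 0 and only the input word, of length
      \<open>m + N + 1\<close>, is nonblank. Since \<open>m >= 1\<close>, \<open>m + N\<close> is at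
      most \<open>m + m * N\<close>.\<close>
    have "tm_space T r m N 0 \<le> card ((UNIV :: tape set) \<times> {0..int (m + N)})"
      unfolding tm_space_def
      by (intro card_mono)
        (simp add: UNIV_tape,
         auto simp: tm_run_def tm_init_def tape_of_def pair_word_def split: if_splits)
    also have "\<dots> = 4 * (m + N + 1)"
      by (simp add: card_cartesian_product UNIV_tape)
    also have "\<dots> \<le> 4 + 4 * num_vars m N" using that by (simp add: num_vars_def)
    finally show ?thesis .
  qed
  have pol: "poly [:4, 4:] x = 4 + 4 * x" for x :: real by simp
  have "(\<exists>t. tm_halts_with T r m N t (\<Xi> \<iota>) \<and> real t \<le> poly [:4, 4:] (real (num_vars m N)) \<and>
        ereal_of_enat (digits (tm_asked T r m N t)) \<le> ereal (poly [:4, 4:] (ln (real (num_vars m N)))) \<and>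
        real (tm_space T r m N t) \<le> poly [:4, 4:] (real (num_vars m N))) \<and>
      (\<exists>t. bss_halts_with P r m N t (\<Xi> \<iota>) \<and> real t \<le> poly [:4, 4:] (real (num_vars m N)) \<and>
        ereal_of_enat (digits (bss_asked P r m N t)) \<le> ereal (poly [:4, 4:] (ln (real (num_vars m N)))))"
    if mN: "(m, N) \<in> D" and \<iota>: "\<iota> \<in> \<Omega> m N" for m N \<iota> r
  proof -
    have m: "1 \<le> m" using D mN by (auto simp: all_dims_def)
    then have "1 \<le> num_vars m N" by (simp add: num_vars_def)
    \<comment> \<open>The digit bound evaluates the polynomial at a logarithm, which has to be
      nonnegative for \<open>4 + 4 * x\<close> to bound 0.\<close>
    then have "0 \<le> ln (real (num_vars m N))" by simp
    moreover have "real (tm_space T r m N 0) \<le> 4 + 4 * real (num_vars m N)"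
      using space[OF m, of r N] by linarith
    ultimately show ?thesis
      using tm[of r m N] tm_asked[of r m N] bss[of r m N] bss_asked[of r m N] dig
      unfolding one[OF mN \<iota>] pol by - (rule conjI, rule exI[of _ 0], simp, rule exI[of _ 1], simp)
  qed
  with wf show ?thesis unfolding polynomially_solvable_def
    by (intro exI[of _ "[:4, 4:]"] exI[of _ T] exI[of _ P]) blast
qed


section \<open>Solvability on the class\<close>

text \<open>With \<open>u\<close> equal to the threshold itself, the second part of the class has
  answer 0 and accumulates at an input with answer 1. A single pair of dimensions in
  \<open>D\<close> suffices.\<close>

lemma jump_class_not_solvable:
  fixes u' :: real and k :: nat
  assumes "0 \<le> M" "D \<subseteq> all_dims" "D \<noteq> {}"
  defines "\<Omega> \<equiv> jump_class (threshold M k) u'"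
  shows "\<not> solvable_in_limit_from_below D \<Omega> (Xi M k)"
    and "p > 1/2 \<Longrightarrow> \<not> solvable_with_probability D \<Omega> (Xi M k) p"
proof -
  obtain m N where D: "(m, N) \<in> D" using assms(3) by auto
  then have "1 \<le> m" "2 \<le> N" using assms(2) by (auto simp: all_dims_def)
  from jump_class_discontinuity[OF this assms(1) less_imp_le[OF threshold_pos[OF assms(1)]] order_refl]
  obtain \<iota>0 r0 where \<iota>0: "\<iota>0 \<in> \<Omega> m N" "represents m N \<iota>0 r0" "Xi M k \<iota>0 = 1"
    and near: "\<And>T. \<exists>\<iota>\<in>\<Omega> m N. \<exists>r. represents m N \<iota> r \<and> Xi M k \<iota> = 0 \<and> (\<forall>j. \<forall>n\<le>T. r j n = r0 j n)"
    unfolding \<Omega>_def by metis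
  have near': "\<exists>\<iota>\<in>\<Omega> m N. \<exists>r. represents m N \<iota> r \<and> Xi M k \<iota> \<noteq> 1 \<and> (\<forall>j. \<forall>n\<le>T. r j n = r0 j n)" for T
    using near[of T] zero_neq_one by metis
  show "\<not> solvable_in_limit_from_below D \<Omega> (Xi M k)"
    using not_solvable_in_limit_from_below[where \<Omega> = \<Omega> and \<Xi> = "Xi M k", OF D \<iota>0 near'] .
  show "\<not> solvable_with_probability D \<Omega> (Xi M k) p" if "p > 1/2"
    using not_solvable_with_probability[where \<Omega> = \<Omega> and \<Xi> = "Xi M k", OF D \<iota>0(1,2) that] near' \<iota>0(3)
    by simp
qed

text \<open>The strict inequality places \<open>u\<close> below and \<open>u'\<close> at the
  threshold of level \<open>k\<close>, so the answer is the sign of the leading entry.\<close>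

lemma jump_class_computable_but_long:
  assumes M: "0 \<le> M" and D: "D \<subseteq> all_dims" and less: "threshold M (Suc k) < threshold M k"
  shows "computable_but_long D (jump_class (threshold M (Suc k)) (threshold M k)) (Xi M k)"
    (is "computable_but_long D ?\<Omega> _")
proof -
  have dims: "1 \<le> m \<and> 2 \<le> N" if "(m, N) \<in> D" for m N using D that by (auto simp: all_dims_def)
  have pos: "0 \<le> threshold M j" for j using threshold_pos[OF M, of j] by simp
  have sgn: "coord m N \<iota> m \<noteq> 0 \<and> Xi M k \<iota> = (if 0 < coord m N \<iota> m then 1 else 0)"
    if "(m, N) \<in> D" "\<iota> \<in> ?\<Omega> m N" for m N \<iota>
    using jump_class_sign[OF _ _ M pos less order_refl that(2)] dims[OF that(1)] by blast
  have close: "\<exists>\<iota>\<in>?\<Omega> m N. \<exists>\<iota>'\<in>?\<Omega> m N. \<exists>r r'. represents m N \<iota> r \<and>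
      represents m N \<iota>' r' \<and> Xi M k \<iota> \<noteq> Xi M k \<iota>' \<and> (\<forall>j. \<forall>n\<le>T. r' j n = r j n)"
    if "(m, N) \<in> D" for m N T
    using jump_class_close_pairs[OF _ _ M pos order_refl] dims[OF that] by blast
  show ?thesis
    unfolding computable_but_long_def
    using sign_machines_compute[of D ?\<Omega> "Xi M k", OF D sgn]
      needs_arbitrarily_longI[of D ?\<Omega> "Xi M k", OF close]
      needs_arbitrarily_long_randomisedI[of D ?\<Omega> "Xi M k", OF close]
    by blast
qed

lemma jump_class_polynomially_solvable:
  assumes M: "0 \<le> M" and D: "D \<subseteq> all_dims" and less: "u < threshold M k" "u' < threshold M k"
    and nonneg: "0 \<le> u" "0 \<le> u'"
  shows "polynomially_solvable D (jump_class u u') (Xi M k)"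
proof (rule polynomially_solvable_const_one[OF D])
  fix m N \<iota> assume "(m, N) \<in> D" and \<iota>: "\<iota> \<in> jump_class u u' m N"
  then have mN: "1 \<le> m" "2 \<le> N" using D by (auto simp: all_dims_def)
  show "Xi M k \<iota> = 1"
    using \<iota> less nonneg Xi_zero_rhs[OF mN M] Xi_jump[OF mN, where M = M] Xi_scaled[OF mN, where M = M]
    unfolding jump_class_def by auto
qed

theorem theorem6p1:
  fixes M :: real and K :: nat
  assumes "M \<ge> 0" and "K > 2"
  shows "(\<exists>\<Omega>. input_class all_dims \<Omega> \<and>
            \<not> solvable_in_limit_from_below all_dims \<Omega> (Xi M K) \<and>
            (\<forall>p > 1/2. \<not> solvable_with_probability all_dims \<Omega> (Xi M K) p) \<and>
            (M \<notin> S9 K \<longrightarrow> computable_but_long all_dims \<Omega> (Xi M (K - 1))) \<and>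
            (M \<notin> S9 (K - 1) \<longrightarrow> polynomially_solvable all_dims \<Omega> (Xi M (K - 2)))) \<and>
         (\<forall>m N. 1 \<le> m \<and> m < N \<and> 4 \<le> N \<longrightarrow>
            (\<exists>\<Omega>. input_class {(m, N)} \<Omega> \<and>
              \<not> solvable_in_limit_from_below {(m, N)} \<Omega> (Xi M K) \<and>
              (\<forall>p > 1/2. \<not> solvable_with_probability {(m, N)} \<Omega> (Xi M K) p) \<and>
              (M \<notin> S9 K \<longrightarrow> computable_but_long {(m, N)} \<Omega> (Xi M (K - 1))))) \<and>
         (\<exists>\<Omega>. input_class all_dims \<Omega> \<and>
            \<not> solvable_in_limit_from_below all_dims \<Omega> (Xi M 1)) \<and>
         (\<forall>m N. 1 \<le> m \<and> m < N \<and> 4 \<le> N \<longrightarrow>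
            (\<exists>\<Omega>. input_class {(m, N)} \<Omega> \<and>
              \<not> solvable_in_limit_from_below {(m, N)} \<Omega> (Xi M 1)))"
proof -
  \<comment> \<open>One family serves every set of dimensions, and its parameter covers level 1 as
    well as level \<open>K\<close>. The threshold at \<open>k - 1\<close> supplies the inputs that
    make the level below slow.\<close>
  define \<Omega> where "\<Omega> = (\<lambda>k. jump_class (threshold M k) (threshold M (k - 1)))"
  have cls: "input_class D (\<Omega> k)" if "D \<subseteq> all_dims" for D k
    unfolding \<Omega>_def using that by (rule input_class_jump_class)
  have no: "\<not> solvable_in_limit_from_below D (\<Omega> k) (Xi M k)"
    "\<forall>p > 1/2. \<not> solvable_with_probability D (\<Omega> k) (Xi M k) p"
    if "D \<subseteq> all_dims" "D \<noteq> {}" for D k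
    unfolding \<Omega>_def using jump_class_not_solvable[OF assms(1) that] by blast+
  obtain k where k: "K = Suc (Suc k)" using assms(2) by (auto dest!: less_imp_Suc_add)
  have long: "computable_but_long D (\<Omega> K) (Xi M (K - 1))" if "D \<subseteq> all_dims" "M \<notin> S9 K" for D
    using jump_class_computable_but_long[OF assms(1) that(1) threshold_Suc_less[OF assms(1)]] that(2)
    unfolding \<Omega>_def k by simp
  have poly: "polynomially_solvable all_dims (\<Omega> K) (Xi M (K - 2))" if "M \<notin> S9 (K - 1)"
  proof -
    \<comment> \<open>Only the comparison of levels \<open>K - 1\<close> and \<open>K - 2\<close>
      has to be strict; the step from \<open>K\<close> to \<open>K - 1\<close> may be an
      equality.\<close>
    have "threshold M (Suc k) < threshold M k"
      using threshold_Suc_less[OF assms(1)] that k by simp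
    moreover from this have "threshold M (Suc (Suc k)) < threshold M k"
      using threshold_Suc_le[of M "Suc k"] by linarith
    ultimately show ?thesis
      using jump_class_polynomially_solvable[OF assms(1) order_refl] threshold_pos[OF assms(1), THEN less_imp_le]
      unfolding \<Omega>_def k by simp
  qed
  have "(1, 2) \<in> all_dims" by (simp add: all_dims_def)
  then have all: "all_dims \<subseteq> all_dims" "all_dims \<noteq> {}" by auto
  have fixed: "{(m, N)} \<subseteq> all_dims" "{(m, N)} \<noteq> {}" if "1 \<le> m \<and> m < N \<and> 4 \<le> N" for m N
    using that by (auto simp: all_dims_def)
  have fixed_dims: "\<exists>\<Omega>. input_class {(m, N)} \<Omega> \<and>
      \<not> solvable_in_limit_from_below {(m, N)} \<Omega> (Xi M K) \<and>
      (\<forall>p > 1/2. \<not> solvable_with_probability {(m, N)} \<Omega> (Xi M K) p) \<and>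
      (M \<notin> S9 K \<longrightarrow> computable_but_long {(m, N)} \<Omega> (Xi M (K - 1)))"
    if "1 \<le> m \<and> m < N \<and> 4 \<le> N" for m N
  proof (intro exI[of _ "\<Omega> K"] conjI impI)
    show "computable_but_long {(m, N)} (\<Omega> K) (Xi M (K - 1))" if "M \<notin> S9 K"
      using long[OF fixed(1) that] \<open>1 \<le> m \<and> m < N \<and> 4 \<le> N\<close> .
  qed (fact cls[OF fixed(1)[OF that]] no[OF fixed[OF that]])+
  have fixed_dims_1: "\<exists>\<Omega>. input_class {(m, N)} \<Omega> \<and>
      \<not> solvable_in_limit_from_below {(m, N)} \<Omega> (Xi M 1)"
    if "1 \<le> m \<and> m < N \<and> 4 \<le> N" for m N
    by (intro exI[of _ "\<Omega> 1"] conjI) (fact cls[OF fixed(1)[OF that]] no(1)[OF fixed[OF that]])+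
  have general: "\<exists>\<Omega>. input_class all_dims \<Omega> \<and>
      \<not> solvable_in_limit_from_below all_dims \<Omega> (Xi M K) \<and>
      (\<forall>p > 1/2. \<not> solvable_with_probability all_dims \<Omega> (Xi M K) p) \<and>
      (M \<notin> S9 K \<longrightarrow> computable_but_long all_dims \<Omega> (Xi M (K - 1))) \<and>
      (M \<notin> S9 (K - 1) \<longrightarrow> polynomially_solvable all_dims \<Omega> (Xi M (K - 2)))"
    by (intro exI[of _ "\<Omega> K"] conjI impI) (fact cls[OF all(1)] no[OF all] | erule long[OF all(1)] poly)+
  have general_1: "\<exists>\<Omega>. input_class all_dims \<Omega> \<and> \<not> solvable_in_limit_from_below all_dims \<Omega> (Xi M 1)"
    by (intro exI[of _ "\<Omega> 1"] conjI) (fact cls[OF all(1)] no(1)[OF all])+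
  show ?thesis
    by (intro conjI allI impI general general_1 fixed_dims fixed_dims_1) simp_all
qed

end
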